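(* Let $(E,B,p,\Gamma)$ be a compact graph bundle, let $F:E\to E$ and $f:B\to B$ be continuous maps with $p\circ F=f\circ p$, and assume $(B,f)$ is minimal. Let $M\subseteq E$ be a minimal set of $F$ with $p(M)=B$. Then exactly one of the following two mutually exclusive possibilities occurs: (A1) $\overline{\operatorname{End}(M)}=M$; moreover this holds if and only if $M$ is nowhere dense in $E$; (A2) $\operatorname{End}(M)=\emptyset$; moreover this holds if and only if $M$ has nonempty interior in $E$. In particular, if $\Gamma$ is a tree, then every such minimal set $M$ is nowhere dense in $E$.
   Context: A graph is a nonempty compact metric space which is the union of finitely many arcs, any two of which are either disjoint or intersect only in one or both of their end-points (a graph need not be connected; a singleton is not a graph). A circle is a simple closed curve; a tree is a graph containing no circle. For a point $x$ of a graph $G$, $\operatorname{ord}(x,G)$ is the number of arcs emanating from $x$; points of order $1$ are end-points, points of order $\ge 3$ are ramification points. For $n\ge1$ the $n$-star $S_n=\{z\in\mathbb C: z^n\in[0,1]\}$ (or any homeomorphic copy) has central point $0$; the open $n$-star $\Sigma_n$ is $S_n$ with its $n$ end-points removed. A compact graph bundle $(E,B,p,\Gamma)$ consists of compact metric spaces $E,B$, a graph $\Gamma$ and a continuous surjection $p:E\to B$ such that every $b\in B$ has an open neighbourhood $U$ (a trivializing neighbourhood) and a homeomorphism $h:p^{-1}(U)\to U\times\Gamma$ with $\mathrm{pr}_1\circ h=p$ (a canonical homeomorphism). For $M\subseteq E$ and $b\in B$, $M_b=M\cap p^{-1}(b)$, and $\Gamma_b=p^{-1}(b)$ (a graph homeomorphic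 to $\Gamma$). A continuous selfmap $g$ of a compact metric space $X$ is minimal if $X$ has no proper nonempty closed subset $A$ with $g(A)\subseteq A$ (equivalently, every forward orbit is dense). A minimal set of $g$ is a nonempty closed set $M$ with $g(M)\subseteq M$ such that $g|_M$ is minimal. Let $Z$ be a closed subset of a graph $\Gamma'$. A point $x\in Z$ is a star-like interior point of $Z$ if some $Z$-open neighbourhood of $x$ is homeomorphic to $\Sigma_k$ for some $k\ge2$ by a homeomorphism sending $x$ to the central point; otherwise $x$ is an end-point of $Z$; $\operatorname{End}(Z)$ denotes the set of end-points of $Z$. For a closed set $M$ in a compact graph bundle, $\operatorname{End}(M)=\bigcup_{b\in B}\operatorname{End}(M_b)$, where $M_b$ is regarded as a closed subset of the graph $\Gamma_b$. *)

theory Defs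
  imports "HOL-Analysis.Analysis"
begin

definition is_graph :: "'a::metric_space set \<Rightarrow> bool" where
  "is_graph G \<longleftrightarrow> (\<exists>A. finite A \<and> A \<noteq> {} \<and> (\<forall>g\<in>A. arc g) \<and>
      G = \<Union>(path_image ` A) \<and>
      (\<forall>g\<in>A. \<forall>h\<in>A. g \<noteq> h \<longrightarrow>
          path_image g \<inter> path_image h \<subseteq>
            {pathstart g, pathfinish g} \<inter> {pathstart h, pathfinish h}))"

definition is_circle :: "'a::metric_space set \<Rightarrow> bool" where
  "is_circle C \<longleftrightarrow> C homeomorphic sphere (0::complex) 1"

definition is_tree :: "'a::metric_space set \<Rightarrow> bool" where
  "is_tree G \<longleftrightarrow> is_graph G \<and> \<not> (\<exists>C. C \<subseteq> G \<and> is_circle C)"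

definition compact_graph_bndl ::
  "'e::metric_space set \<Rightarrow> 'b::metric_space set \<Rightarrow> ('e \<Rightarrow> 'b) \<Rightarrow> 'g::metric_space set \<Rightarrow> bool" where
  "compact_graph_bndl E B p \<Gamma> \<longleftrightarrow>
     compact E \<and> compact B \<and> is_graph \<Gamma> \<and> continuous_on E p \<and> p ` E = B \<and>
     (\<forall>b\<in>B. \<exists>U. openin (top_of_set B) U \<and> b \<in> U \<and>
        (\<exists>h k. homeomorphism (E \<inter> p -` U) (U \<times> \<Gamma>) h k \<and>
               (\<forall>x\<in>E \<inter> p -` U. fst (h x) = p x)))"

text \<open>Open n-star: the n-star with its n end-points removed.\<close>
definition open_star :: "nat \<Rightarrow> complex set" where
  "open_star n = {z. \<exists>t::real. 0 \<le> t \<and> t < 1 \<and> z ^ n = complex_of_real t}"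

definition minimal_on :: "'a::topological_space set \<Rightarrow> ('a \<Rightarrow> 'a) \<Rightarrow> bool" where
  "minimal_on X g \<longleftrightarrow>
     (\<forall>A. closedin (top_of_set X) A \<and> A \<noteq> {} \<and> g ` A \<subseteq> A \<longrightarrow> A = X)"

definition minimal_set :: "'a::topological_space set \<Rightarrow> ('a \<Rightarrow> 'a) \<Rightarrow> 'a set \<Rightarrow> bool" where
  "minimal_set X g M \<longleftrightarrow> M \<noteq> {} \<and> closedin (top_of_set X) M \<and> g ` M \<subseteq> M \<and> minimal_on M g"

definition star_like_interior_pt :: "'a::topological_space set \<Rightarrow> 'a \<Rightarrow> bool" where
  "star_like_interior_pt Z x \<longleftrightarrow> x \<in> Z \<and>
     (\<exists>V k. openin (top_of_set Z) V \<and> x \<in> V \<and> k \<ge> 2 \<and>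
        (\<exists>h h'. homeomorphism V (open_star k) h h' \<and> h x = 0))"

definition end_points :: "'a::topological_space set \<Rightarrow> 'a set" where
  "end_points Z = {x\<in>Z. \<not> star_like_interior_pt Z x}"

definition End_of :: "'e::topological_space set \<Rightarrow> 'b set \<Rightarrow> ('e \<Rightarrow> 'b) \<Rightarrow> 'e set \<Rightarrow> 'e set" where
  "End_of E B p M = (\<Union>b\<in>B. end_points (M \<inter> E \<inter> p -` {b}))"

end

theory Submission
  imports Defs
begin

text \<open>
  Call \<open>x\<close> an arc-interior point of \<open>Z\<close> if it is an inner point of an arc in \<open>Z\<close>. In a graph, a closed
  set \<open>T\<close> all of whose points are arc-interior contains every edge whose interior it meets; hence all
  its points are star-like, there are only finitely many such \<open>T\<close>, and if nonempty it contains a circle.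

  If an open set misses \<open>End(M)\<close>, then inside some box \<open>U \<times> J\<close>, \<open>J\<close> an open arc, every
  \<open>M\<^sub>b\<close> contains \<open>J\<close> or misses it, and semi-openness of \<open>p\<close> on \<open>M\<close> gives interior points of \<open>M\<close>.

  Conversely let \<open>M\<close> have interior. Minimal maps are irreducible, so the points where \<open>F\<close> is injective on
  \<open>M\<close> up to \<open>\<epsilon>\<close> form a dense open set, and over a residual backward invariant set of base points \<open>F\<close>
  can neither collapse nor fold an arc of \<open>M\<^sub>b\<close>. There \<open>F\<close> maps arc-interior points to
  arc-interior points, so the set \<open>Z\<close> of the other points satisfies \<open>Z \<subseteq> F(Z)\<close>, which forces \<open>Z\<close> to be
  empty or dense in \<open>M\<close>; it is not dense because it misses an open subset of the interior.
  Finitely many possible fibres then carry the conclusion over to all base points.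
\<close>

section \<open>Minimal maps\<close>

text \<open>The obstacle is that minimality speaks about open subsets of \<open>M\<close>, while
  end-points are defined fibre by fibre, and a piece of one fibre is usually not open in
  \<open>M\<close>. Near-injectivity of \<open>F\<close> therefore reaches fibres only through Baire
  category, at the price of exceptional base points. Since preimages of bad points have to stay over
  good base points, the exceptional set must absorb its own forward images; that it remains meagre
  is again due to minimality, now of \<open>f\<close>. Arc-interior points replace star-like ones
  because the property is monotone in the set. To recognise an image point it is enough to find two
  different germs in the image fibre, whatever else that fibre contains, and in the final limit only
  an inclusion of fibres is known. Nothing is lost, for on a closed subset of a graph consisting
  entirely of arc-interior points the two notions agree.\<close>

lemma closedin_self_diff: "openin (top_of_set X) W \<Longrightarrow> closedin (top_of_set X) (X - W)"
  using closedin_diff[OF closedin_topspace, of "top_of_set X" W] by simp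

lemma openin_self_diff: "closedin (top_of_set X) A \<Longrightarrow> openin (top_of_set X) (X - A)"
  using openin_diff[OF openin_topspace, of "top_of_set X" A] by simp

lemma funpow_closed_on:
  assumes "f ` X \<subseteq> X" "x \<in> X" shows "(f ^^ n) x \<in> X"
  by (induction n) (use assms in auto)

lemma continuous_on_funpow:
  assumes "continuous_on X f" "f ` X \<subseteq> X" shows "continuous_on X (f ^^ n)"
proof (induction n)
  case 0 show ?case by (simp add: id_def continuous_on_id)
next
  case (Suc n)
  have "(f ^^ n) ` X \<subseteq> X" using funpow_closed_on[OF assms(2)] by auto
  then show ?case
    unfolding funpow.simps by (rule continuous_on_compose[OF Suc continuous_on_subset[OF assms(1)]])
qed

text \<open>The points whose whole forward orbit stays in \<open>A\<close> form a closed invariant set, which is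
  nonempty by compactness because every point of \<open>A\<close> has arbitrarily long backward orbits in \<open>A\<close>.\<close>

lemma minimal_backward:
  fixes f :: "'a::metric_space \<Rightarrow> 'a"
  assumes X: "compact X" and f: "continuous_on X f" "f ` X \<subseteq> X" "minimal_on X f"
    and A: "closedin (top_of_set X) A" "A \<noteq> {}" "A \<subseteq> f ` A"
  shows "A = X"
proof -
  define C where "C n = {x \<in> X. \<forall>k\<le>n. (f ^^ k) x \<in> A}" for n :: nat
  have AX: "A \<subseteq> X" using A(1) closedin_imp_subset by blast
  have clo: "closedin (top_of_set X) (C n)" for n
  proof -
    have "C n = (\<Inter>k\<in>{..n}. X \<inter> (f ^^ k) -` A)" by (auto simp: C_def)
    moreover have "closedin (top_of_set X) (X \<inter> (f ^^ k) -` A)" for k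
      by (rule continuous_closedin_preimage_gen[OF continuous_on_funpow[OF f(1,2)] _ A(1)])
         (use funpow_closed_on[OF f(2)] in auto)
    ultimately show ?thesis by (metis (no_types, lifting) atMost_iff closedin_INT empty_iff le0)
  qed
  have backward: "\<exists>x\<in>C n. (f ^^ n) x = a" if "a \<in> A" for a n
    using that
  proof (induction n arbitrary: a)
    case 0 then show ?case using AX by (auto simp: C_def)
  next
    case (Suc n)
    then obtain a' where a': "a' \<in> A" "a = f a'" using A(3) by blast
    from Suc.IH[OF a'(1)] obtain x where "x \<in> C n" "(f ^^ n) x = a'" by blast
    then show ?case using a' Suc.prems by (intro bexI[of _ x]) (auto simp: C_def le_Suc_eq)
  qed
  define D where "D = (\<Inter>n. C n)"
  have "X \<inter> D \<noteq> {}" unfolding D_def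
  proof (rule compact_imp_fip_image[OF X])
    show "closed (C n)" for n using closedin_compact[OF X clo] compact_imp_closed by blast
    fix I :: "nat set" assume "finite I"
    then obtain n where n: "I \<subseteq> {..n}" using finite_nat_iff_bounded_le by blast
    obtain x where "x \<in> C n" using backward A(2) by blast
    then have "x \<in> X \<inter> (\<Inter>i\<in>I. C i)" using n by (force simp: C_def)
    then show "X \<inter> (\<Inter>i\<in>I. C i) \<noteq> {}" by blast
  qed
  then have "D \<noteq> {}" by blast
  moreover have "closedin (top_of_set X) D" unfolding D_def by (rule closedin_INT) (use clo in auto)
  moreover have "f ` D \<subseteq> D"
  proof
    fix y assume "y \<in> f ` D"
    then obtain x where x: "x \<in> D" "y = f x" by blast
    then have "(f ^^ k) x \<in> A" "x \<in> X" for k by (auto simp: D_def C_def)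
    then have "(f ^^ Suc k) x \<in> A" "x \<in> X" for k by blast+
    then show "y \<in> D" using x(2) f(2) by (auto simp: D_def C_def funpow_swap1)
  qed
  ultimately have "D = X" using f(3) unfolding minimal_on_def by blast
  moreover have "C 0 \<subseteq> A" by (auto simp: C_def)
  moreover have "D \<subseteq> C 0" unfolding D_def by blast
  ultimately show ?thesis using AX by blast
qed

lemma minimal_surj:
  fixes f :: "'a::metric_space \<Rightarrow> 'a"
  assumes X: "compact X" and f: "continuous_on X f" "f ` X \<subseteq> X" "minimal_on X f"
  shows "f ` X = X"
proof (cases "X = {}")
  case False
  have "closedin (top_of_set X) (f ` X)"
    using compact_continuous_image[OF f(1) X] f(2) by (simp add: closedin_closed_eq closed_subset compact_imp_closed)
  then show ?thesis using f(2,3) False unfolding minimal_on_def by blast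
qed auto

lemma compact_image_closedin:
  fixes f :: "'a::metric_space \<Rightarrow> 'b::metric_space"
  assumes "compact X" "continuous_on X f" "f ` X \<subseteq> Y" "closedin (top_of_set X) A"
  shows "closedin (top_of_set Y) (f ` A)"
proof -
  have "A \<subseteq> X" using assms(4) closedin_imp_subset by blast
  moreover have "compact (f ` A)"
    using closedin_compact[OF assms(1,4)] assms(2) \<open>A \<subseteq> X\<close>
    by (meson compact_continuous_image continuous_on_subset)
  ultimately show ?thesis using assms(3) by (intro closed_subset compact_imp_closed) auto
qed

text \<open>The set in question consists of the points all of whose preimages lie in
  \<open>W\<close>. Were it empty, the closed set \<open>X - W\<close> would be covered by its own
  image, and \<open>minimal_backward\<close> would make it all of \<open>X\<close>.\<close>

lemma minimal_irreducible:
  fixes f :: "'a::metric_space \<Rightarrow> 'a"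
  assumes X: "compact X" and f: "continuous_on X f" "f ` X \<subseteq> X" "minimal_on X f"
    and W: "openin (top_of_set X) W" "W \<noteq> {}"
  shows "openin (top_of_set X) (X - f ` (X - W))" "X - f ` (X - W) \<noteq> {}" "X - f ` (X - W) \<subseteq> f ` W"
proof -
  have clo: "closedin (top_of_set X) (X - W)" using W(1) by (rule closedin_self_diff)
  show "openin (top_of_set X) (X - f ` (X - W))"
    using compact_image_closedin[OF X f(1,2) clo] by (rule openin_self_diff)
  show "X - f ` (X - W) \<subseteq> f ` W" using minimal_surj[OF X f] by blast
  have WX: "W \<subseteq> X" using W(1) openin_imp_subset by blast
  show "X - f ` (X - W) \<noteq> {}"
  proof
    assume "X - f ` (X - W) = {}"
    then have sub: "X - W \<subseteq> f ` (X - W)" "X \<subseteq> f ` (X - W)" by auto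
    then have "X - W \<noteq> {}" using W(2) WX by auto
    then have "X - W = X" using minimal_backward[OF X f clo] sub by blast
    then show False using W(2) WX by blast
  qed
qed

section \<open>Closed nowhere dense sets under a minimal map\<close>

definition closed_nowhere_dense :: "'a::topological_space set \<Rightarrow> 'a set \<Rightarrow> bool" where
  "closed_nowhere_dense X N \<longleftrightarrow> closedin (top_of_set X) N \<and> (\<forall>W. openin (top_of_set X) W \<and> W \<subseteq> N \<longrightarrow> W = {})"

text \<open>A general continuous map can spread a Cantor set over an interval. Here irreducibility,
  applied to the points outside \<open>N\<close> that are sent into \<open>W\<close>, gives a point
  of \<open>W\<close> none of whose preimages lies in \<open>N\<close>.\<close>

lemma closed_nowhere_dense_image:
  fixes f :: "'a::metric_space \<Rightarrow> 'a"
  assumes X: "compact X" and f: "continuous_on X f" "f ` X \<subseteq> X" "minimal_on X f" and N: "closed_nowhere_dense X N"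
  shows "closed_nowhere_dense X (f ` N)"
  unfolding closed_nowhere_dense_def
proof (intro conjI allI impI)
  have cN: "closedin (top_of_set X) N" using N by (simp add: closed_nowhere_dense_def)
  then have NX: "N \<subseteq> X" using closedin_imp_subset by blast
  show "closedin (top_of_set X) (f ` N)" by (rule compact_image_closedin[OF X f(1,2) cN])
  fix W assume W: "openin (top_of_set X) W \<and> W \<subseteq> f ` N"
  show "W = {}"
  proof (rule ccontr)
    assume ne: "W \<noteq> {}"
    define V where "V = (X \<inter> f -` W) - N"
    have op: "openin (top_of_set X) (X \<inter> f -` W)"
      using W f(1,2) by (meson continuous_openin_preimage image_subset_iff_funcset)
    then have "openin (top_of_set X) V" unfolding V_def using cN by (rule openin_diff)
    moreover have "V \<noteq> {}"
    proof
      assume "V = {}"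
      then have "X \<inter> f -` W \<subseteq> N" by (auto simp: V_def)
      then have "X \<inter> f -` W = {}" using N op unfolding closed_nowhere_dense_def by blast
      then show False using ne W NX by blast
    qed
    ultimately have "X - f ` (X - V) \<noteq> {}" using minimal_irreducible(2)[OF X f] by blast
    then obtain y where y: "y \<in> X" "y \<notin> f ` (X - V)" by blast
    then obtain x where x: "x \<in> X" "y = f x" using minimal_surj[OF X f] by blast
    then have "x \<in> V" using y by blast
    then have "y \<in> f ` N" using W x unfolding V_def by blast
    then show False using y NX unfolding V_def by blast
  qed
qed

lemma closed_nowhere_dense_funpow_image:
  fixes f :: "'a::metric_space \<Rightarrow> 'a"
  assumes X: "compact X" and f: "continuous_on X f" "f ` X \<subseteq> X" "minimal_on X f" and N: "closed_nowhere_dense X N"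
  shows "closed_nowhere_dense X ((f ^^ n) ` N)"
proof (induction n)
  case 0 then show ?case using N by simp
next
  case (Suc n) then show ?case using closed_nowhere_dense_image[OF X f Suc] by (simp add: image_comp)
qed

text \<open>By irreducibility the image of a nonempty open set contains a nonempty open set, which
  therefore cannot lie in \<open>N\<close>.\<close>

lemma closed_nowhere_dense_vimage:
  fixes f :: "'a::metric_space \<Rightarrow> 'a"
  assumes X: "compact X" and f: "continuous_on X f" "f ` X \<subseteq> X" "minimal_on X f" and N: "closed_nowhere_dense X N"
  shows "closed_nowhere_dense X (X \<inter> f -` N)"
  unfolding closed_nowhere_dense_def
proof (intro conjI allI impI)
  show "closedin (top_of_set X) (X \<inter> f -` N)"
    by (rule continuous_closedin_preimage_gen[OF f(1), where T = X]) (use N f(2) in \<open>auto simp: closed_nowhere_dense_def\<close>)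
  fix W assume W: "openin (top_of_set X) W \<and> W \<subseteq> X \<inter> f -` N"
  show "W = {}"
  proof (rule ccontr)
    assume "W \<noteq> {}"
    note i = minimal_irreducible[OF X f conjunct1[OF W] this]
    have "X - f ` (X - W) \<subseteq> N" using i(3) W by blast
    then show False using i(1,2) N unfolding closed_nowhere_dense_def by blast
  qed
qed

lemma closed_nowhere_dense_funpow_vimage:
  fixes f :: "'a::metric_space \<Rightarrow> 'a"
  assumes X: "compact X" and f: "continuous_on X f" "f ` X \<subseteq> X" "minimal_on X f" and N: "closed_nowhere_dense X N"
  shows "closed_nowhere_dense X (X \<inter> (f ^^ n) -` N)"
proof (induction n)
  case 0
  have "N \<subseteq> X" using N unfolding closed_nowhere_dense_def using closedin_imp_subset by blast
  then have "X \<inter> (f ^^ 0) -` N = N" by auto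
  then show ?case using N by simp
next
  case (Suc n)
  have "X \<inter> (f ^^ Suc n) -` N = X \<inter> f -` (X \<inter> (f ^^ n) -` N)"
    using f(2) by (auto simp: funpow_swap1)
  then show ?case using closed_nowhere_dense_vimage[OF X f Suc] by metis
qed

lemma closed_nowhere_dense_countable_Union:
  fixes X :: "'a::metric_space set"
  assumes X: "compact X" and c: "countable \<G>" and N: "\<And>N. N \<in> \<G> \<Longrightarrow> closed_nowhere_dense X N"
    and W: "openin (top_of_set X) W" "W \<subseteq> \<Union>\<G>"
  shows "W = {}"
proof -
  have "(top_of_set X) interior_of \<Union>\<G> = {}"
  proof (rule Baire_category_alt)
    have "compact_space (top_of_set X)" "metrizable_space (top_of_set X)"
      using X by (auto simp: compact_space_subtopology metrizable_space_subtopology metrizable_space_euclidean)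
    then show "completely_metrizable_space (top_of_set X) \<or>
        locally_compact_space (top_of_set X) \<and> regular_space (top_of_set X)"
      by (simp add: compact_imp_locally_compact_space metrizable_imp_regular_space)
    show "countable \<G>" by fact
    show "closedin (top_of_set X) T \<and> top_of_set X interior_of T = {}" if "T \<in> \<G>" for T
      using N[OF that] unfolding closed_nowhere_dense_def
      by (meson interior_of_subset openin_interior_of)
  qed
  then show ?thesis using W interior_of_maximal by blast
qed

section \<open>Orbits and factor maps\<close>

lemma minimal_orbit_meets_open:
  fixes f :: "'a::metric_space \<Rightarrow> 'a"
  assumes f: "continuous_on X f" "f ` X \<subseteq> X" "minimal_on X f"
    and W: "openin (top_of_set X) W" "W \<noteq> {}" and x: "x \<in> X"
  shows "\<exists>n. (f ^^ n) x \<in> W"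
proof (rule ccontr)
  assume no: "\<nexists>n. (f ^^ n) x \<in> W"
  define A where "A = (\<Inter>n. X \<inter> (f ^^ n) -` (X - W))"
  have "closedin (top_of_set X) (X \<inter> (f ^^ n) -` (X - W))" for n
  proof (rule continuous_closedin_preimage_gen[OF continuous_on_funpow[OF f(1,2)]])
    show "f ^^ n \<in> X \<rightarrow> X" using funpow_closed_on[OF f(2)] by auto
    show "closedin (top_of_set X) (X - W)" using W(1) by (rule closedin_self_diff)
  qed
  then have "closedin (top_of_set X) A" unfolding A_def by blast
  moreover have "x \<in> A" using no x funpow_closed_on[OF f(2)] by (auto simp: A_def)
  moreover have "f ` A \<subseteq> A"
  proof
    fix y assume "y \<in> f ` A"
    then obtain z where z: "z \<in> A" "y = f z" by blast
    then have "z \<in> X" "(f ^^ Suc n) z \<in> X - W" for n by (auto simp: A_def simp del: funpow.simps)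
    then show "y \<in> A" using z f(2) by (auto simp: A_def funpow_swap1)
  qed
  ultimately have "A = X" using f(3) unfolding minimal_on_def by blast
  moreover have "A \<subseteq> X \<inter> (f ^^ 0) -` (X - W)" unfolding A_def by blast
  ultimately show False using W openin_imp_subset[OF W(1)] by auto
qed

text \<open>Every orbit of \<open>F\<close> visits a small ball inside \<open>W\<close>, so
  \<open>B\<close> is a countable union of preimages, under iterates of \<open>f\<close>, of the
  image of that ball. By Baire category this image is not nowhere dense.\<close>

lemma minimal_factor_semiopen:
  fixes F :: "'a::metric_space \<Rightarrow> 'a" and f :: "'b::metric_space \<Rightarrow> 'b"
  assumes M: "compact M" and F: "continuous_on M F" "F ` M \<subseteq> M" "minimal_on M F"
    and B: "compact B" and f: "continuous_on B f" "f ` B \<subseteq> B" "minimal_on B f"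
    and p: "continuous_on M p" "p ` M = B" "\<And>x. x \<in> M \<Longrightarrow> p (F x) = f (p x)"
    and W: "openin (top_of_set M) W" "W \<noteq> {}"
  shows "\<exists>V. openin (top_of_set B) V \<and> V \<noteq> {} \<and> V \<subseteq> p ` W"
proof -
  obtain x where x: "x \<in> W" using W by blast
  have WM: "W \<subseteq> M" using W openin_imp_subset by blast
  \<comment> \<open>A closed ball is taken so that its image under \<open>p\<close> is compact and
    hence closed.\<close>
  obtain e where e: "e > 0" "cball x e \<inter> M \<subseteq> W"
    using W(1) x unfolding openin_contains_cball by blast
  define K where "K = cball x e \<inter> M"
  have K: "closedin (top_of_set M) K" unfolding K_def by (simp add: closedin_closed_Int Int_commute)
  have cpK: "closedin (top_of_set B) (p ` K)"
    by (rule compact_image_closedin[OF M p(1) _ K]) (use p(2) in blast)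
  have pF: "p ((F ^^ n) y) = (f ^^ n) (p y)" if "y \<in> M" for n y
    using that by (induction n) (auto simp: p(3) funpow_closed_on[OF F(2)])
  have "\<not> closed_nowhere_dense B (p ` K)"
  proof
    assume n: "closed_nowhere_dense B (p ` K)"
    define \<G> where "\<G> = range (\<lambda>n. B \<inter> (f ^^ n) -` (p ` K))"
    have "B \<subseteq> \<Union>\<G>"
    proof
      fix b assume "b \<in> B"
      then obtain y where y: "y \<in> M" "p y = b" using p(2) by blast
      have "openin (top_of_set M) (ball x e \<inter> M)" by (metis Int_commute open_ball openin_open_Int)
      moreover have "x \<in> ball x e \<inter> M" using x WM e by auto
      ultimately obtain n where "(F ^^ n) y \<in> ball x e \<inter> M"
        using minimal_orbit_meets_open[OF F _ _ y(1)] by blast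
      then have "(F ^^ n) y \<in> K" unfolding K_def by (auto simp: less_imp_le)
      then have "(f ^^ n) b \<in> p ` K" using pF[OF y(1)] y(2) by (metis imageI)
      then show "b \<in> \<Union>\<G>" using \<open>b \<in> B\<close> by (auto simp: \<G>_def)
    qed
    moreover have "closed_nowhere_dense B N" if "N \<in> \<G>" for N
      using that closed_nowhere_dense_funpow_vimage[OF B f n] by (auto simp: \<G>_def)
    ultimately have "B = {}"
      using closed_nowhere_dense_countable_Union[OF B, of \<G> B] by (auto simp: \<G>_def)
    then show False using x WM p(2) by blast
  qed
  then obtain V where "openin (top_of_set B) V" "V \<subseteq> p ` K" "V \<noteq> {}" using cpK unfolding closed_nowhere_dense_def by blast
  moreover have "p ` K \<subseteq> p ` W" using e(2) by (auto simp: K_def)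
  ultimately show ?thesis by (meson order_trans)
qed

section \<open>Arcs and stars in graphs\<close>

text \<open>The case \<open>a > b\<close> is allowed and reverses the direction: the arm running
  from \<open>g u\<close> back to \<open>g 0\<close> is \<open>segpath g u 0\<close>. Images are
  written with \<open>closed_segment\<close> to treat both orders at once.\<close>

definition segpath :: "(real \<Rightarrow> 'a) \<Rightarrow> real \<Rightarrow> real \<Rightarrow> real \<Rightarrow> 'a" where
  "segpath g a b = (\<lambda>t. g (a + (b - a) * t))"

lemma segpath_image_Icc:
  assumes "a \<noteq> b" "0 \<le> t"
  shows "segpath g a b ` {0..t} = g ` closed_segment a (a + (b - a) * t)"
proof -
  have "(\<lambda>s. a + (b - a) * s) ` {0..t} = closed_segment a (a + (b - a) * t)"
  proof (cases "a < b")
    case True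
    then have "(\<lambda>s. (b - a) * s + a) ` {0..t} = {a..a + (b - a) * t}"
      using image_affinity_atLeastAtMost[of "b - a" a 0 t] assms by (auto simp: algebra_simps)
    then show ?thesis using True assms(2) by (simp add: closed_segment_eq_real_ivl add.commute mult_nonneg_nonneg)
  next
    case False
    then have "b - a < 0" using assms by auto
    then have "(\<lambda>s. (b - a) * s + a) ` {0..t} = {a + (b - a) * t..a}"
      using image_affinity_atLeastAtMost[of "b - a" a 0 t] assms by (auto simp: algebra_simps)
    moreover have "(b - a) * t \<le> 0" using \<open>b - a < 0\<close> assms(2) by (simp add: mult_le_0_iff)
    ultimately show ?thesis by (simp add: closed_segment_eq_real_ivl add.commute)
  qed
  then show ?thesis unfolding segpath_def by (metis image_image)
qed

lemma path_image_segpath: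
  "a \<noteq> b \<Longrightarrow> path_image (segpath g a b) = g ` closed_segment a b"
  using segpath_image_Icc[of a b 1 g] by (simp add: path_image_def)

lemma segpath_ends [simp]:
  "pathstart (segpath g a b) = g a" "pathfinish (segpath g a b) = g b"
  by (simp_all add: segpath_def pathstart_def pathfinish_def)

lemma segment_in_unit: "0 \<le> a \<Longrightarrow> a \<le> 1 \<Longrightarrow> 0 \<le> b \<Longrightarrow> b \<le> 1 \<Longrightarrow> closed_segment a b \<subseteq> {0..1::real}"
  by (auto simp: closed_segment_eq_real_ivl split: if_splits)

lemma arc_segpath:
  fixes g :: "real \<Rightarrow> 'a::topological_space"
  assumes g: "arc g" and ab: "0 \<le> a" "a \<le> 1" "0 \<le> b" "b \<le> 1" "a \<noteq> b"
  shows "arc (segpath g a b)"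
proof -
  let ?\<phi> = "\<lambda>t::real. a + (b - a) * t"
  have im: "?\<phi> ` {0..1} \<subseteq> {0..1}"
  proof -
    have "segpath (\<lambda>x. x) a b ` {0..1} = closed_segment a b"
      using segpath_image_Icc[of a b 1 "\<lambda>x. x"] ab by simp
    then show ?thesis using segment_in_unit[OF ab(1-4)] by (simp add: segpath_def)
  qed
  have "continuous_on {0..1} (g \<circ> ?\<phi>)"
    by (rule continuous_on_compose)
       (use g im in \<open>auto intro!: continuous_intros continuous_on_subset[of "{0..1}" g] simp: arc_def path_def\<close>)
  moreover have "inj_on (g \<circ> ?\<phi>) {0..1}"
  proof (rule comp_inj_on)
    show "inj_on ?\<phi> {0..1}" using ab(5) by (auto simp: inj_on_def)
    show "inj_on g (?\<phi> ` {0..1})" using g im by (auto simp: arc_def intro: inj_on_subset)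
  qed
  ultimately show ?thesis by (simp add: arc_def path_def segpath_def comp_def)
qed

section \<open>Arc-interior points, stars and free arcs\<close>

definition arc_interior_pt :: "'a::topological_space set \<Rightarrow> 'a \<Rightarrow> bool" where
  "arc_interior_pt Z x \<longleftrightarrow> (\<exists>g. arc g \<and> path_image g \<subseteq> Z \<and> x \<in> g ` {0<..<1})"

lemma arc_interior_pt_mono: "arc_interior_pt Z x \<Longrightarrow> Z \<subseteq> Z' \<Longrightarrow> arc_interior_pt Z' x"
  unfolding arc_interior_pt_def by blast

text \<open>The closed arms meet only in \<open>x\<close>, tips included, so a point other than
  \<open>x\<close> determines its arm and its parameter (see \<open>star_atD\<close>). The
  neighbourhood is formed by the half-open arms, because a tip may be a branch point of
  \<open>G\<close>.\<close>

definition star_at :: "'a::metric_space set \<Rightarrow> 'a \<Rightarrow> (real \<Rightarrow> 'a) set \<Rightarrow> bool" where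
  "star_at G x A \<longleftrightarrow> finite A \<and> (\<forall>g\<in>A. arc g \<and> pathstart g = x \<and> path_image g \<subseteq> G) \<and>
     (\<forall>g\<in>A. \<forall>h\<in>A. g \<noteq> h \<longrightarrow> path_image g \<inter> path_image h = {x}) \<and>
     openin (top_of_set G) (insert x (\<Union>g\<in>A. g ` {0..<1}))"

definition free_arc :: "'a::metric_space set \<Rightarrow> (real \<Rightarrow> 'a) \<Rightarrow> bool" where
  "free_arc G g \<longleftrightarrow> arc g \<and> path_image g \<subseteq> G \<and> openin (top_of_set G) (g ` {0<..<1})"

lemma arc_compact_image:
  fixes g :: "real \<Rightarrow> 'a::metric_space"
  assumes "arc g" "0 \<le> a" "b \<le> 1"
  shows "compact (g ` {a..b})"
  using assms by (intro compact_continuous_image) (auto simp: arc_def path_def intro: continuous_on_subset)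

lemma arc_connected_image:
  assumes "arc g" "0 \<le> a" "b \<le> 1"
  shows "connected (g ` {a..b})"
  using assms by (intro connected_continuous_image) (auto simp: arc_def path_def intro: continuous_on_subset)

lemma arc_inj: "arc g \<Longrightarrow> s \<in> {0..1} \<Longrightarrow> t \<in> {0..1} \<Longrightarrow> g s = g t \<Longrightarrow> s = t"
  by (auto simp: arc_def dest: inj_onD)

lemma star_atD:
  assumes "star_at G x A"
  shows "finite A" "g \<in> A \<Longrightarrow> arc g" "g \<in> A \<Longrightarrow> g 0 = x" "g \<in> A \<Longrightarrow> path_image g \<subseteq> G"
    "g \<in> A \<Longrightarrow> h \<in> A \<Longrightarrow> s \<in> {0..1} \<Longrightarrow> t \<in> {0..1} \<Longrightarrow> g s = h t \<Longrightarrow> g = h \<and> s = t \<or> s = 0 \<and> t = 0"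
    "openin (top_of_set G) (insert x (\<Union>g\<in>A. g ` {0..<1}))"
proof -
  show "finite A" "g \<in> A \<Longrightarrow> arc g" "g \<in> A \<Longrightarrow> path_image g \<subseteq> G"
    "openin (top_of_set G) (insert x (\<Union>g\<in>A. g ` {0..<1}))"
    using assms by (auto simp: star_at_def)
  show start: "g 0 = x" if "g \<in> A" for g using assms that by (auto simp: star_at_def pathstart_def)
  assume gh: "g \<in> A" "h \<in> A" "s \<in> {0..1}" "t \<in> {0..1}" "g s = h t"
  then have arcs: "arc g" "arc h" using assms by (auto simp: star_at_def)
  show "g = h \<and> s = t \<or> s = 0 \<and> t = 0"
  proof (cases "g = h")
    case True then show ?thesis using gh arc_inj[OF arcs(1)] by blast
  next
    case False
    have "g s \<in> path_image g" "h t \<in> path_image h" using gh(3,4) by (auto simp: path_image_def)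
    then have "g s \<in> path_image g \<inter> path_image h" using gh(5) by simp
    then have "g s = x" using assms gh(1,2) False unfolding star_at_def by auto
    then have "g s = g 0" "h t = h 0" using start gh by auto
    then show ?thesis using arc_inj[OF arcs(1), of s 0] arc_inj[OF arcs(2), of t 0] gh by auto
  qed
qed

lemma openin_restrict:
  assumes "openin (top_of_set G) N" "Q \<subseteq> G"
  shows "openin (top_of_set Q) (Q \<inter> N)"
  using assms by (auto simp: openin_open)

lemma openin_diff_compact:
  fixes G :: "'a::metric_space set"
  assumes "openin (top_of_set G) N" "compact K"
  shows "openin (top_of_set G) (N - K)"
proof -
  have "closedin (top_of_set G) (G \<inter> K)" using assms(2) by (simp add: closedin_closed_Int compact_imp_closed)
  then have "openin (top_of_set G) (N - G \<inter> K)" using assms(1) by (rule openin_diff[rotated])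
  moreover have "N - G \<inter> K = N - K" using openin_imp_subset[OF assms(1)] by auto
  ultimately show ?thesis by simp
qed

text \<open>What is cut off, the union of the outer pieces of the arms, is compact. The place of the
  cut may vary from arm to arm; \<open>connected_contains_germ\<close> depends on this
  freedom.\<close>

lemma star_shrink:
  assumes st: "star_at G x A" and t: "\<And>g. g \<in> A \<Longrightarrow> 0 < t g \<and> t g \<le> (1::real)"
  shows "openin (top_of_set G) (insert x (\<Union>g\<in>A. g ` {0..<t g}))"
proof -
  note D = star_atD[OF st]
  let ?N = "insert x (\<Union>g\<in>A. g ` {0..<1})" and ?K = "\<Union>g\<in>A. g ` {t g..1}"
  have "compact ?K" using D(1,2) t by (intro compact_UN arc_compact_image) (auto simp: less_imp_le)
  then have "openin (top_of_set G) (?N - ?K)" using D(6) by (intro openin_diff_compact)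
  moreover have "?N - ?K = insert x (\<Union>g\<in>A. g ` {0..<t g})" (is "_ = ?R")
  proof
    show "?N - ?K \<subseteq> ?R" by fastforce
    show "?R \<subseteq> ?N - ?K"
    proof
      fix y assume y: "y \<in> ?R"
      have "y \<noteq> h u" if h: "h \<in> A" "u \<in> {t h..1}" for h u
      proof
        assume e: "y = h u"
        have u: "0 < u" "u \<le> 1" using h t[OF h(1)] by auto
        consider "y = x" | g s where "g \<in> A" "0 \<le> s" "s < t g" "y = g s" using y by auto
        then show False
        proof cases
          case 1 then show False using D(3)[OF h(1)] D(5)[OF h(1) h(1), of u 0] e u by auto
        next
          case 2
          then show False using D(5)[OF h(1) 2(1), of u s] e u t[OF 2(1)] h by auto
        qed
      qed
      moreover have "y \<in> ?N" using y t by fastforce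
      ultimately show "y \<in> ?N - ?K" by blast
    qed
  qed
  ultimately show ?thesis by simp
qed

text \<open>Removing the centre and the other closed arms, a compact set, from the open star leaves
  exactly the open arm.\<close>

lemma star_free:
  assumes st: "star_at G x A" and g: "g \<in> A"
  shows "free_arc G g"
proof -
  note D = star_atD[OF st]
  let ?N = "insert x (\<Union>g\<in>A. g ` {0..<1})" and ?K = "insert x (\<Union>h\<in>A-{g}. path_image h)"
  have "compact ?K" using D(1,2) by (intro compact_insert compact_UN) (auto simp: compact_arc_image)
  then have "openin (top_of_set G) (?N - ?K)" using D(6) by (intro openin_diff_compact)
  moreover have "?N - ?K = g ` {0<..<1}"
  proof
    show "?N - ?K \<subseteq> g ` {0<..<1}"
    proof
      fix y assume y: "y \<in> ?N - ?K"
      then obtain h s where h: "h \<in> A" "0 \<le> s" "s < 1" "y = h s" by auto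
      then have "y \<in> path_image h" by (auto simp: path_image_def)
      then have "h = g" using y h by auto
      moreover have "s \<noteq> 0" using y h D(3) by auto
      ultimately show "y \<in> g ` {0<..<1}" using h by auto
    qed
    show "g ` {0<..<1} \<subseteq> ?N - ?K"
    proof
      fix y assume "y \<in> g ` {0<..<1}"
      then obtain s where s: "0 < s" "s < 1" "y = g s" by auto
      then have "y \<in> ?N" using g by fastforce
      moreover have "y \<noteq> x" using D(3)[OF g] D(5)[OF g g, of s 0] s by auto
      moreover have "y \<notin> path_image h" if "h \<in> A - {g}" for h
      proof
        assume "y \<in> path_image h"
        then obtain r where "r \<in> {0..1}" "g s = h r" using s(3) by (auto simp: path_image_def)
        then show False using D(5)[OF g, of h s r] that s by auto
      qed
      ultimately show "y \<in> ?N - ?K" by blast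
    qed
  qed
  ultimately show ?thesis using D(2,4)[OF g] by (simp add: free_arc_def)
qed

lemma free_subarc_open:
  assumes "free_arc G g" "0 \<le> a" "b \<le> 1"
  shows "openin (top_of_set G) (g ` {a<..<b})"
proof (cases "a < b")
  case True
  have g: "arc g" "openin (top_of_set G) (g ` {0<..<1})" using assms(1) by (auto simp: free_arc_def)
  have "openin (top_of_set G) (g ` {0<..<1} - (g ` {0..a} \<union> g ` {b..1}))"
    using assms True by (intro openin_diff_compact g compact_Un arc_compact_image) auto
  moreover have "g ` {0<..<1} - (g ` {0..a} \<union> g ` {b..1}) = g ` {a<..<b}"
  proof -
    have "g ` {0<..<1} - g ` ({0..a} \<union> {b..1}) = g ` ({0<..<1} - ({0..a} \<union> {b..1}))"
      by (rule inj_on_image_set_diff[symmetric, of _ "{0..1}"]) (use g(1) assms True in \<open>auto simp: arc_def\<close>)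
    also have "{0<..<1} - ({0..a} \<union> {b..1}) = {a<..<b}" using assms True by auto
    finally show ?thesis by (simp add: image_Un)
  qed
  ultimately show ?thesis by simp
qed auto

lemma free_star:
  assumes f: "free_arc G g" and u: "0 < u" "u < 1"
  shows "star_at G (g u) {segpath g u 1, segpath g u 0}" "segpath g u 1 \<noteq> segpath g u 0"
proof -
  have g: "arc g" "path_image g \<subseteq> G" "openin (top_of_set G) (g ` {0<..<1})" using f by (auto simp: free_arc_def)
  have im: "path_image (segpath g u 1) = g ` {u..1}" "path_image (segpath g u 0) = g ` {0..u}"
    using u by (auto simp: path_image_segpath closed_segment_eq_real_ivl)
  have "g ` {u..1} \<inter> g ` {0..u} = g ` ({u..1} \<inter> {0..u})"
    by (rule inj_on_image_Int[symmetric, of _ "{0..1}"]) (use g(1) u in \<open>auto simp: arc_def\<close>)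
  also have "{u..1} \<inter> {0..u} = {u}" using u by auto
  finally have "g ` {u..1} \<inter> g ` {0..u} = {g u}" by simp
  then have inter: "path_image (segpath g u 1) \<inter> path_image (segpath g u 0) = {g u}" by (simp add: im)
  have half: "segpath g u 1 ` {0..<1} = g ` {u..<1}" "segpath g u 0 ` {0..<1} = g ` {0<..u}"
  proof -
    have "(\<lambda>t. u + (1 - u) * t) ` {0..<1} = {u..<1}"
    proof -
      have "y \<in> (\<lambda>t. u + (1 - u) * t) ` {0..<1}" if "y \<in> {u..<1}" for y
        using that u by (intro image_eqI[of _ _ "(y - u) / (1 - u)"]) auto
      moreover have "u + (1 - u) * t < 1" if "t < 1" for t
      proof -
        have "(1 - u) * t < (1 - u) * 1" using that u by (intro mult_strict_left_mono) auto
        then have "u + (1 - u) * t < u + (1 - u) * 1" by (rule add_strict_left_mono)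
        then show ?thesis by simp
      qed
      ultimately show ?thesis using u by (auto simp: mult_nonneg_nonneg)
    qed
    then show "segpath g u 1 ` {0..<1} = g ` {u..<1}" unfolding segpath_def by (metis image_image)
    have "(\<lambda>t. u + (0 - u) * t) ` {0..<1} = {0<..u}"
    proof -
      have "y \<in> (\<lambda>t. u + (0 - u) * t) ` {0..<1}" if "y \<in> {0<..u}" for y
        using that u by (intro image_eqI[of _ _ "(u - y) / u"]) auto
      moreover have "u * t < u" if "t < 1" for t using that u by simp
      ultimately show ?thesis using u by (auto simp: mult_nonneg_nonneg)
    qed
    then show "segpath g u 0 ` {0..<1} = g ` {0<..u}" unfolding segpath_def by (metis image_image)
  qed
  have "insert (g u) (g ` {u..<1} \<union> g ` {0<..u}) = g ` ({u..<1} \<union> {0<..u})" using u by auto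
  also have "{u..<1} \<union> {0<..u} = {0<..<1}" using u by auto
  finally have N: "insert (g u) (\<Union>h\<in>{segpath g u 1, segpath g u 0}. h ` {0..<1}) = g ` {0<..<1}"
    by (simp add: half)
  have "path_image (segpath g u 1) \<subseteq> path_image g" "path_image (segpath g u 0) \<subseteq> path_image g"
    unfolding im using u by (auto simp: path_image_def)
  then have "path_image (segpath g u 1) \<subseteq> G" "path_image (segpath g u 0) \<subseteq> G" using g(2) by auto
  then show "star_at G (g u) {segpath g u 1, segpath g u 0}"
    unfolding star_at_def N using u g inter by (auto intro!: arc_segpath simp: Int_commute)
  have "g 1 \<noteq> g 0" using arc_inj[OF g(1), of 1 0] by auto
  then show "segpath g u 1 \<noteq> segpath g u 0" by (metis segpath_ends(2))
qed

text \<open>If no initial piece of an arm lies in \<open>Q\<close>, then arbitrarily small truncated stars have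
  their boundary outside \<open>Q\<close>.\<close>

lemma connected_contains_germ:
  assumes st: "star_at G x A" and Q: "Q \<subseteq> G" "connected Q" "x \<in> Q" "Q \<noteq> {x}"
  shows "\<exists>g\<in>A. \<exists>t. 0 < t \<and> t \<le> 1 \<and> g ` {0..t} \<subseteq> Q"
proof (rule ccontr)
  assume no: "\<not> ?thesis"
  note D = star_atD[OF st]
  obtain y where y: "y \<in> Q" "y \<noteq> x" using Q by blast
  have "\<exists>s. 0 < s \<and> s \<le> 1 \<and> g s \<notin> Q \<and> y \<notin> g ` {0..<s}" if g: "g \<in> A" for g
  proof -
    \<comment> \<open>\<open>t0\<close> keeps the truncated arm away from \<open>y\<close>; the
      final contradiction is that \<open>y\<close> would lie in the truncated star.\<close>
    have "\<exists>t0. 0 < t0 \<and> t0 \<le> 1 \<and> y \<notin> g ` {0..<t0}"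
    proof (cases "y \<in> path_image g")
      case True
      then obtain u where u: "0 \<le> u" "u \<le> 1" "y = g u" by (auto simp: path_image_def)
      then have "u \<noteq> 0" using y(2) D(3)[OF g] by auto
      then show ?thesis using u arc_inj[OF D(2)[OF g]] by (intro exI[of _ u]) force
    next
      case False
      then show ?thesis by (intro exI[of _ 1]) (auto simp: path_image_def)
    qed
    then obtain t0 where t0: "0 < t0" "t0 \<le> 1" "y \<notin> g ` {0..<t0}" by blast
    then have "\<not> g ` {0..t0} \<subseteq> Q" using no g by blast
    then have "\<exists>s\<in>{0..t0}. g s \<notin> Q" by auto
    then obtain s where s: "0 \<le> s" "s \<le> t0" "g s \<notin> Q" by auto
    then have "s \<noteq> 0" using D(3)[OF g] Q(3) by auto
    then show ?thesis using s t0 by (intro exI[of _ s]) auto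
  qed
  then obtain s where s: "\<And>g. g \<in> A \<Longrightarrow> 0 < s g \<and> s g \<le> 1 \<and> g (s g) \<notin> Q \<and> y \<notin> g ` {0..<s g}"
    by metis
  then have s01: "0 < s g" "s g \<le> 1" if "g \<in> A" for g using that by auto
  let ?O = "insert x (\<Union>g\<in>A. g ` {0..<s g})" and ?C = "insert x (\<Union>g\<in>A. g ` {0..s g})"
  have "openin (top_of_set G) ?O" by (rule star_shrink[OF st]) (use s01 in blast)
  then have o: "openin (top_of_set Q) (Q \<inter> ?O)" using Q(1) by (rule openin_restrict)
  have "compact ?C" by (intro compact_insert compact_UN arc_compact_image D(1) D(2) s01(2)) auto
  then have "closedin (top_of_set Q) (Q \<inter> ?C)" by (simp add: closedin_closed_Int compact_imp_closed)
  \<comment> \<open>The cuts \<open>g (s g)\<close> lie outside \<open>Q\<close>, so the open and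
    the closed truncated star have the same trace on \<open>Q\<close>. This trace is clopen in
    \<open>Q\<close> and contains \<open>x\<close>, hence is all of the connected set
    \<open>Q\<close>.\<close>
  moreover have "Q \<inter> ?C = Q \<inter> ?O"
  proof
    show "Q \<inter> ?C \<subseteq> Q \<inter> ?O"
    proof
      fix z assume z: "z \<in> Q \<inter> ?C"
      show "z \<in> Q \<inter> ?O"
      proof (cases "z = x")
        case False
        then obtain g r where g: "g \<in> A" "r \<in> {0..s g}" "z = g r" using z by auto
        then have "r \<noteq> s g" using z s by auto
        then show ?thesis using g z by fastforce
      qed (use Q in auto)
    qed
    have "{0..<s g} \<subseteq> {0..s g}" for g by auto
    then show "Q \<inter> ?O \<subseteq> Q \<inter> ?C" by blast
  qed
  ultimately have "closedin (top_of_set Q) (Q \<inter> ?O)" by simp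
  then have "Q \<inter> ?O = {} \<or> Q \<inter> ?O = Q" using o Q(2) unfolding connected_clopen by meson
  then have "y \<in> ?O" using Q(3) y(1) by blast
  then show False using s y(2) by blast
qed

text \<open>The two germs, joined at \<open>x\<close>, form an arc that passes through
  \<open>x\<close> at parameter 1/2.\<close>

lemma two_germs_arc_interior:
  assumes st: "star_at G x A" and g: "g1 \<in> A" "g2 \<in> A" "g1 \<noteq> g2" and t: "0 < t" "t \<le> 1"
    and Z: "g1 ` {0..t} \<subseteq> Z" "g2 ` {0..t} \<subseteq> Z"
  shows "arc_interior_pt Z x"
proof -
  note D = star_atD[OF st]
  have im: "path_image (segpath g1 t 0) = g1 ` {0..t}" "path_image (segpath g2 0 t) = g2 ` {0..t}"
    using t by (auto simp: path_image_segpath closed_segment_eq_real_ivl)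
  have "g1 ` {0..t} \<inter> g2 ` {0..t} \<subseteq> {x}"
  proof
    fix y assume "y \<in> g1 ` {0..t} \<inter> g2 ` {0..t}"
    then obtain r s where "r \<in> {0..t}" "s \<in> {0..t}" "y = g1 r" "g1 r = g2 s" by auto
    then show "y \<in> {x}" using D(5)[OF g(1,2), of r s] D(3)[OF g(1)] g(3) t by auto
  qed
  then have "arc (segpath g1 t 0 +++ segpath g2 0 t)"
    using t D(2) g D(3)[OF g(1)] D(3)[OF g(2)] by (intro arc_join arc_segpath) (auto simp: im)
  moreover have "path_image (segpath g1 t 0 +++ segpath g2 0 t) \<subseteq> Z"
    using Z D(3)[OF g(1)] D(3)[OF g(2)] by (subst path_image_join) (auto simp: im)
  moreover have "x = (segpath g1 t 0 +++ segpath g2 0 t) (1/2)"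
    using D(3)[OF g(1)] by (simp add: joinpaths_def segpath_def)
  ultimately show ?thesis unfolding arc_interior_pt_def by (intro exI conjI) auto
qed

text \<open>Cut the arc at \<open>x\<close>: each half is connected and so contains a germ of an
  arm. The arms differ because the halves share only \<open>x\<close>.\<close>

lemma arc_interior_two_germs:
  assumes st: "star_at G x A" and Z: "Z \<subseteq> G" "arc_interior_pt Z x"
  obtains g1 g2 t where "g1 \<in> A" "g2 \<in> A" "g1 \<noteq> g2" "0 < t" "t \<le> 1" "g1 ` {0..t} \<subseteq> Z" "g2 ` {0..t} \<subseteq> Z"
proof -
  note D = star_atD[OF st]
  obtain a s where a: "arc a" "path_image a \<subseteq> Z" "0 < s" "s < 1" "x = a s"
    using Z(2) by (auto simp: arc_interior_pt_def)
  have sub: "a ` {0..s} \<subseteq> Z" "a ` {s..1} \<subseteq> Z" using a by (auto simp: path_image_def)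
  have "a 0 \<noteq> x" using a arc_inj[OF a(1), of 0 s] by auto
  moreover have "a 1 \<noteq> x" using a arc_inj[OF a(1), of 1 s] by auto
  ultimately have ne: "a ` {0..s} \<noteq> {x}" "a ` {s..1} \<noteq> {x}" using a by force+
  obtain g1 t1 where 1: "g1 \<in> A" "0 < t1" "t1 \<le> 1" "g1 ` {0..t1} \<subseteq> a ` {0..s}"
    using connected_contains_germ[OF st, of "a ` {0..s}"] sub Z(1) ne a arc_connected_image[OF a(1), of 0 s] by force
  obtain g2 t2 where 2: "g2 \<in> A" "0 < t2" "t2 \<le> 1" "g2 ` {0..t2} \<subseteq> a ` {s..1}"
    using connected_contains_germ[OF st, of "a ` {s..1}"] sub Z(1) ne a arc_connected_image[OF a(1), of s 1] by force
  define t where "t = min t1 t2"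
  have t: "0 < t" "t \<le> 1" "g1 ` {0..t} \<subseteq> a ` {0..s}" "g2 ` {0..t} \<subseteq> a ` {s..1}"
    using 1 2 by (fastforce simp: t_def)+
  have "g1 \<noteq> g2"
  proof
    assume eq: "g1 = g2"
    have "g1 t \<in> a ` {0..s} \<inter> a ` {s..1}" using t eq by auto
    then obtain q r where "g1 t = a q" "g1 t = a r" "0 \<le> q" "q \<le> s" "s \<le> r" "r \<le> 1" by auto
    then have "g1 t = x" using a arc_inj[OF a(1), of q r] by auto
    then show False using D(3)[OF 1(1)] D(5)[OF 1(1) 1(1), of t 0] t by auto
  qed
  moreover have "g1 ` {0..t} \<subseteq> Z" "g2 ` {0..t} \<subseteq> Z" using order_trans[OF t(3) sub(1)] order_trans[OF t(4) sub(2)] by auto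
  ultimately show thesis using 1(1) 2(1) t(1,2) by (intro that[of g1 g2 t])
qed

text \<open>The trace of \<open>T\<close> on the open arc is clopen in this connected set. It is
  open because an inner point of a free arc has just two arms, so that the two germs from
  \<open>arc_interior_two_germs\<close> fill a neighbourhood. The ends of the arc follow by
  closedness of \<open>T\<close>.\<close>

lemma free_arc_dichotomy:
  assumes f: "free_arc G g" and T: "closed T" "T \<subseteq> G"
    and ai: "\<And>y. y \<in> T \<Longrightarrow> y \<in> g ` {0<..<1} \<Longrightarrow> arc_interior_pt T y"
  shows "path_image g \<subseteq> T \<or> g ` {0<..<1} \<inter> T = {}"
proof -
  have g: "arc g" "openin (top_of_set G) (g ` {0<..<1})" using f by (auto simp: free_arc_def)
  let ?J = "g ` {0<..<1}"
  have cg: "continuous_on {0..1} g" using g(1) by (simp add: arc_def path_def)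
  have "connected ?J" by (intro connected_continuous_image continuous_on_subset[OF cg]) auto
  moreover have "closedin (top_of_set ?J) (?J \<inter> T)" using T(1) by (simp add: closedin_closed_Int)
  moreover have "openin (top_of_set ?J) (?J \<inter> T)"
  proof (subst openin_subopen, intro ballI)
    fix y assume y: "y \<in> ?J \<inter> T"
    then obtain u where u: "0 < u" "u < 1" "y = g u" by auto
    note st = free_star[OF f u(1,2)]
    obtain g1 g2 t where h: "g1 \<in> {segpath g u 1, segpath g u 0}" "g2 \<in> {segpath g u 1, segpath g u 0}"
      "g1 \<noteq> g2" "0 < t" "t \<le> 1" "g1 ` {0..t} \<subseteq> T" "g2 ` {0..t} \<subseteq> T"
      by (rule arc_interior_two_germs[OF st(1) T(2)]) (use ai y u(3) in auto)
    let ?O = "insert (g u) (\<Union>h\<in>{segpath g u 1, segpath g u 0}. h ` {0..<t})"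
    have sT: "h ` {0..<t} \<subseteq> T" if "h \<in> {segpath g u 1, segpath g u 0}" for h
    proof -
      have "{0..<t} \<subseteq> {0..t}" by auto
      then show ?thesis using h that by blast
    qed
    have "openin (top_of_set G) ?O" using h by (intro star_shrink[OF st(1)]) auto
    then have "openin (top_of_set ?J) (?J \<inter> ?O)"
      using openin_imp_subset[OF g(2)] by (rule openin_restrict)
    moreover have "?O \<subseteq> T" using sT y u(3) by (intro insert_subsetI UN_least) auto
    then have "?J \<inter> ?O \<subseteq> ?J \<inter> T" by (rule Int_mono[OF order_refl])
    moreover have "y \<in> ?J \<inter> ?O" using y u by auto
    ultimately show "\<exists>T'. openin (top_of_set ?J) T' \<and> y \<in> T' \<and> T' \<subseteq> ?J \<inter> T" by blast
  qed
  ultimately have "?J \<inter> T = {} \<or> ?J \<inter> T = ?J" unfolding connected_clopen by blast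
  moreover have "path_image g \<subseteq> T" if "?J \<subseteq> T"
  proof -
    have "closure {0<..<1::real} = {0..1}" by simp
    then have "g ` closure {0<..<1} \<subseteq> T"
      by (intro image_closure_subset) (use cg T(1) that in auto)
    then show ?thesis by (simp add: path_image_def)
  qed
  ultimately show ?thesis by blast
qed

lemma segpath_image_open:
  assumes "0 \<le> a" "a < b" "b \<le> 1"
  shows "segpath g a b ` {0<..<1} = g ` {a<..<b}"
proof -
  have "(\<lambda>t. a + (b - a) * t) ` {0<..<1} = {a<..<b}"
  proof -
    have "y \<in> (\<lambda>t. a + (b - a) * t) ` {0<..<1}" if "y \<in> {a<..<b}" for y
      using that assms by (intro image_eqI[of _ _ "(y - a) / (b - a)"]) auto
    moreover have "a + (b - a) * t \<in> {a<..<b}" if "0 < t" "t < 1" for t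
    proof -
      have "(b - a) * t < (b - a) * 1" using that assms by (intro mult_strict_left_mono) auto
      then have "a + (b - a) * t < a + (b - a) * 1" by (rule add_strict_left_mono)
      then show ?thesis using that assms by simp
    qed
    ultimately show ?thesis by auto
  qed
  then show ?thesis unfolding segpath_def by (metis image_image)
qed

lemma free_arc_segpath:
  assumes "free_arc G g" "0 \<le> a" "a < b" "b \<le> 1"
  shows "free_arc G (segpath g a b)"
proof -
  have "path_image (segpath g a b) \<subseteq> path_image g"
    using assms unfolding path_image_def[of g]
    by (subst path_image_segpath) (auto simp: closed_segment_eq_real_ivl)
  then show ?thesis
    using assms arc_segpath[of g a b] free_subarc_open[OF assms(1,2,4)] segpath_image_open[OF assms(2-4), of g]
    unfolding free_arc_def by auto
qed

subsection \<open>Homeomorphisms onto open stars\<close>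

text \<open>Written in the shape of \<open>complex_root_unity\<close> and
  \<open>complex_roots_unity\<close>, which are applied to it below.\<close>

definition unit_root :: "nat \<Rightarrow> nat \<Rightarrow> complex" where
  "unit_root k j = exp (2 * of_real pi * \<i> * of_nat j / of_nat k)"

lemma norm_unit_root [simp]: "norm (unit_root k j) = 1"
proof -
  have "2 * of_real pi * \<i> * of_nat j / of_nat k = \<i> * of_real (2 * pi * real j / real k)" by simp
  then show ?thesis unfolding unit_root_def by (metis norm_exp_i_times)
qed

lemma unit_root_power: "k \<ge> 1 \<Longrightarrow> unit_root k j ^ k = 1"
  unfolding unit_root_def by (intro complex_root_unity) auto

lemma ray_unique:
  assumes "0 \<le> r" "0 \<le> s" "i < k" "j < k" "of_real r * unit_root k i = of_real s * unit_root k j"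
  shows "r = s" "r \<noteq> 0 \<Longrightarrow> i = j"
proof -
  have "norm (of_real r * unit_root k i) = norm (of_real s * unit_root k j)" using assms(5) by simp
  then show "r = s" using assms(1,2) by (simp add: norm_mult)
  assume "r \<noteq> 0"
  then have "unit_root k i = unit_root k j" using assms(5) \<open>r = s\<close> by simp
  then have "i mod k = j mod k" unfolding unit_root_def using assms(3) by (subst (asm) complex_root_unity_eq) (auto simp: cong_def)
  then show "i = j" using assms(3,4) by simp
qed

text \<open>Polar decomposition: a nonzero \<open>z\<close> is \<open>norm z\<close> times a root of
  unity. The hypothesis on \<open>C\<close> lets one set serve both for the radii and for their
  \<open>k\<close>-th powers, as \<open>{0..<1}\<close> does.\<close>

lemma star_rays:
  assumes k: "k \<ge> 1" and C: "C \<subseteq> {0..}" "\<And>r. r \<in> C \<longleftrightarrow> 0 \<le> r \<and> r ^ k \<in> C"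
  shows "{z. \<exists>t\<in>C. z ^ k = complex_of_real t} = (\<Union>j<k. (\<lambda>r. of_real r * unit_root k j) ` C)"
proof
  show "(\<Union>j<k. (\<lambda>r. of_real r * unit_root k j) ` C) \<subseteq> {z. \<exists>t\<in>C. z ^ k = complex_of_real t}"
  proof clarify
    fix j r assume "r \<in> C"
    then have "r ^ k \<in> C" using C(2) by blast
    moreover have "(of_real r * unit_root k j) ^ k = of_real (r ^ k)" using k by (simp add: power_mult_distrib unit_root_power)
    ultimately show "\<exists>t\<in>C. (of_real r * unit_root k j) ^ k = of_real t" by blast
  qed
  show "{z. \<exists>t\<in>C. z ^ k = complex_of_real t} \<subseteq> (\<Union>j<k. (\<lambda>r. of_real r * unit_root k j) ` C)"
  proof clarify
    fix z t assume t: "t \<in> C" "z ^ k = complex_of_real t"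
    have "norm z ^ k = t" using t C(1) by (metis abs_of_nonneg atLeast_iff norm_of_real norm_power subsetD)
    then have nC: "norm z \<in> C" using C(2)[of "norm z"] t(1) by auto
    show "z \<in> (\<Union>j<k. (\<lambda>r. of_real r * unit_root k j) ` C)"
    proof (cases "z = 0")
      case True
      then have "z = of_real (norm z) * unit_root k 0" by simp
      then show ?thesis using nC k by (intro UN_I[of 0]) auto
    next
      case False
      then have "t \<noteq> 0" using t(2) k by (metis of_real_0 power_not_zero)
      have "(z / of_real (norm z)) ^ k = 1"
        using t(2) \<open>norm z ^ k = t\<close> \<open>t \<noteq> 0\<close> by (simp add: power_divide flip: of_real_power)
      then have "z / of_real (norm z) \<in> {unit_root k j |j. j < k}"
        using complex_roots_unity[OF k] unfolding unit_root_def by blast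
      then obtain j where "j < k" "z / of_real (norm z) = unit_root k j" by blast
      moreover from this have "z = of_real (norm z) * unit_root k j" using False by (simp add: field_simps)
      ultimately show ?thesis using nC by blast
    qed
  qed
qed

lemma open_star_rays:
  assumes "k \<ge> 1" shows "open_star k = (\<Union>j<k. (\<lambda>r. of_real r * unit_root k j) ` {0..<1})"
proof -
  have "open_star k = {z. \<exists>t\<in>{0..<1}. z ^ k = complex_of_real t}" by (auto simp: open_star_def)
  also have "\<dots> = (\<Union>j<k. (\<lambda>r. of_real r * unit_root k j) ` {0..<1})"
    using assms by (intro star_rays) (auto simp: power_less_one_iff)
  finally show ?thesis .
qed

text \<open>The map is built from the model to the space, and on closed rays: pasting finitely many
  closed pieces gives continuity, and compactness turns the continuous injection into a
  homeomorphism. Only then is it restricted to the open star and inverted.\<close>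

lemma star_homeomorphism:
  fixes x :: "'a::metric_space"
  assumes fin: "finite A" "card A = k" "k \<ge> 1"
    and arcs: "\<And>g. g \<in> A \<Longrightarrow> arc g" "\<And>g. g \<in> A \<Longrightarrow> g 0 = x"
    and dis: "\<And>g h s t. g \<in> A \<Longrightarrow> h \<in> A \<Longrightarrow> s \<in> {0..1} \<Longrightarrow> t \<in> {0..1} \<Longrightarrow> g s = h t \<Longrightarrow> g = h \<and> s = t \<or> s = 0 \<and> t = 0"
  shows "\<exists>h h'. homeomorphism (insert x (\<Union>g\<in>A. g ` {0..<1})) (open_star k) h h' \<and> h x = 0"
proof -
  obtain \<phi> where \<phi>: "bij_betw \<phi> {..<k} A"
    using ex_bij_betw_nat_finite[OF fin(1)] fin(2) by (auto simp: atLeast0LessThan)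
  have \<phi>A: "\<phi> j \<in> A" if "j < k" for j using \<phi> that by (auto simp: bij_betw_def)
  define R where "R j = (\<lambda>r. complex_of_real r * unit_root k j) ` {0..1}" for j
  define S where "S = (\<Union>j<k. R j)"
  have cR: "compact (R j)" for j unfolding R_def by (intro compact_continuous_image continuous_intros) auto
  have cS: "compact S" unfolding S_def using cR by (intro compact_UN) auto
  \<comment> \<open>Distinct rays overlap only at 0, where every arm takes the value
    \<open>x\<close>.\<close>
  have key: "\<phi> i (norm z) = \<phi> j (norm z)" if ij: "i < k" "j < k" and zz: "z \<in> R i" "z \<in> R j" for i j z
  proof -
    obtain r s where rs: "z = of_real r * unit_root k i" "z = of_real s * unit_root k j" "0 \<le> r" "0 \<le> s"
      using zz unfolding R_def by (elim imageE) (metis atLeastAtMost_iff)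
    note u = ray_unique[OF rs(3,4) ij]
    show ?thesis
    proof (cases "r = 0")
      case True then show ?thesis using rs(1) arcs(2)[OF \<phi>A[OF ij(1)]] arcs(2)[OF \<phi>A[OF ij(2)]] by simp
    next
      case False
      then have "i = j" using u(2) rs(1,2) by metis
      then show ?thesis by simp
    qed
  qed
  obtain \<Phi> where \<Phi>: "continuous_map (top_of_set S) euclidean \<Phi>"
      "\<And>z i. \<lbrakk>i \<in> {..<k}; z \<in> topspace (top_of_set S) \<inter> R i\<rbrakk> \<Longrightarrow> \<Phi> z = \<phi> i (norm z)"
  proof (rule pasting_lemma_exists_closed[of "{..<k}" "top_of_set S" R euclidean "\<lambda>i z. \<phi> i (norm z)"])
    show "topspace (top_of_set S) \<subseteq> \<Union> (R ` {..<k})" by (simp add: S_def)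
    show "closedin (top_of_set S) (R i)" if "i \<in> {..<k}" for i
      using that cR by (intro closed_subset compact_imp_closed) (auto simp: S_def)
    show "continuous_map (subtopology (top_of_set S) (R i)) euclidean (\<lambda>z. \<phi> i (norm z))" if "i \<in> {..<k}" for i
    proof -
      have "continuous_on (S \<inter> R i) (\<phi> i \<circ> norm)"
      proof (rule continuous_on_compose)
        have "norm ` (S \<inter> R i) \<subseteq> {0..1}" by (auto simp: R_def norm_mult)
        then show "continuous_on (norm ` (S \<inter> R i)) (\<phi> i)"
          using arcs(1)[OF \<phi>A[of i]] that by (auto simp: arc_def path_def intro: continuous_on_subset)
      qed (intro continuous_intros)
      then show ?thesis by (simp add: subtopology_subtopology comp_def)
    qed
    show "\<phi> i (norm z) = \<phi> j (norm z)" if "i \<in> {..<k}" "j \<in> {..<k}" "z \<in> topspace (top_of_set S) \<inter> R i \<inter> R j" for i j z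
      using that by (intro key) auto
    show "finite {..<k}" by simp
  qed (rule that; blast)
  have \<Phi>r: "\<Phi> (of_real r * unit_root k j) = \<phi> j r" if "j < k" "r \<in> {0..1}" for j r
  proof -
    have "of_real r * unit_root k j \<in> R j" using that(2) unfolding R_def by blast
    moreover from this have "of_real r * unit_root k j \<in> S" using that(1) unfolding S_def by blast
    moreover have "norm (of_real r * unit_root k j) = r" using that(2) by (simp add: norm_mult)
    ultimately show ?thesis using \<Phi>(2)[of j "of_real r * unit_root k j"] that(1) by simp
  qed
  have inj: "inj_on \<Phi> S"
  proof (rule inj_onI)
    fix z w assume "z \<in> S" "w \<in> S" and eq: "\<Phi> z = \<Phi> w"
    then obtain i j r s where z: "i < k" "j < k" "r \<in> {0..1}" "s \<in> {0..1}"
      "z = of_real r * unit_root k i" "w = of_real s * unit_root k j" unfolding S_def R_def by blast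
    then have "\<phi> i r = \<phi> j s" using eq \<Phi>r by simp
    then have "\<phi> i = \<phi> j \<and> r = s \<or> r = 0 \<and> s = 0" using dis \<phi>A z by blast
    then show "z = w"
    proof
      assume "\<phi> i = \<phi> j \<and> r = s"
      then have "i = j" using \<phi> z(1,2) by (metis bij_betw_inv_into_left lessThan_iff)
      then show ?thesis using z \<open>\<phi> i = \<phi> j \<and> r = s\<close> by simp
    qed (use z in simp)
  qed
  have "continuous_on S \<Phi>" using \<Phi>(1) by simp
  then obtain \<Psi> where hom: "homeomorphism S (\<Phi> ` S) \<Phi> \<Psi>" using homeomorphism_compact[OF cS _ refl inj] by blast
  have sub: "open_star k \<subseteq> S" unfolding open_star_rays[OF fin(3)] S_def R_def by fastforce
  have "\<Phi> ` open_star k = (\<Union>j<k. (\<Phi> \<circ> (\<lambda>r. of_real r * unit_root k j)) ` {0..<1})"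
    unfolding open_star_rays[OF fin(3)] by (simp add: image_UN image_comp)
  also have "\<dots> = (\<Union>j<k. \<phi> j ` {0..<1})"
    by (intro SUP_cong image_cong refl) (auto simp: \<Phi>r)
  also have "\<dots> = (\<Union>g\<in>\<phi> ` {..<k}. g ` {0..<1})" by simp
  also have "\<phi> ` {..<k} = A" using \<phi> by (simp add: bij_betw_def)
  also have "(\<Union>g\<in>A. g ` {0..<1}) = insert x (\<Union>g\<in>A. g ` {0..<1})"
  proof -
    have "\<phi> 0 \<in> A" "x = \<phi> 0 0" using \<phi>A[of 0] arcs(2) fin(3) by auto
    then have "x \<in> (\<Union>g\<in>A. g ` {0..<1})" by (intro UN_I[of "\<phi> 0"]) auto
    then show ?thesis by blast
  qed
  finally have im: "\<Phi> ` open_star k = insert x (\<Union>g\<in>A. g ` {0..<1})" .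
  have "homeomorphism (open_star k) (insert x (\<Union>g\<in>A. g ` {0..<1})) \<Phi> \<Psi>"
    using homeomorphism_of_subsets[OF hom sub subset_refl im] .
  moreover have "\<Psi> x = 0"
  proof -
    have "0 \<in> open_star k" using fin(3) by (auto simp: open_star_def intro!: exI[of _ 0])
    then have "0 \<in> S" using sub by blast
    moreover have "\<Phi> 0 = x" using \<Phi>r[of 0 0] fin(3) arcs(2)[OF \<phi>A[of 0]] by simp
    ultimately show ?thesis using hom homeomorphism_apply1 by fastforce
  qed
  ultimately show ?thesis using homeomorphism_symD by blast
qed

text \<open>By \<open>free_arc_dichotomy\<close> an arm that meets \<open>T\<close> strictly between
  its ends lies wholly in \<open>T\<close>. Near \<open>x\<close>, therefore, \<open>T\<close> is
  the star with the arms in \<open>A'\<close>, and there are at least two of these because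
  \<open>x\<close> is arc-interior.\<close>

lemma star_like_if_arc_interior:
  assumes st: "star_at G x A" and T: "closed T" "T \<subseteq> G" and ai: "\<And>y. y \<in> T \<Longrightarrow> arc_interior_pt T y" and x: "x \<in> T"
  shows "star_like_interior_pt T x"
proof -
  note D = star_atD[OF st]
  define A' where "A' = {g \<in> A. path_image g \<subseteq> T}"
  have mem: "g \<in> A'" if "g \<in> A" "g s \<in> T" "0 < s" "s < 1" for g s
  proof -
    have "g s \<in> g ` {0<..<1} \<inter> T" using that by auto
    then have "path_image g \<subseteq> T" using free_arc_dichotomy[OF star_free[OF st that(1)] T] ai by blast
    then show ?thesis using that(1) by (simp add: A'_def)
  qed
  let ?N = "insert x (\<Union>g\<in>A. g ` {0..<1})" and ?V = "insert x (\<Union>g\<in>A'. g ` {0..<1})"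
  have "T \<inter> ?N = ?V"
  proof
    show "T \<inter> ?N \<subseteq> ?V"
    proof
      fix y assume y: "y \<in> T \<inter> ?N"
      show "y \<in> ?V"
      proof (cases "y = x")
        case False
        then obtain g s where g: "g \<in> A" "0 \<le> s" "s < 1" "y = g s" using y by auto
        then have "s \<noteq> 0" using False D(3) by auto
        then have "g \<in> A'" using mem[of g s] g y by auto
        moreover have "y \<in> g ` {0..<1}" using g by simp
        ultimately show ?thesis by blast
      qed auto
    qed
    have "g ` {0..<1} \<subseteq> T" if "g \<in> A'" for g
    proof -
      have "g ` {0..<1} \<subseteq> path_image g" by (auto simp: path_image_def)
      then show ?thesis using that by (auto simp: A'_def)
    qed
    then show "?V \<subseteq> T \<inter> ?N" using x by (auto simp: A'_def)
  qed
  then have op: "openin (top_of_set T) ?V" using openin_restrict[OF D(6) T(2)] by simp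
  obtain g1 g2 t where g: "g1 \<in> A" "g2 \<in> A" "g1 \<noteq> g2" "0 < t" "t \<le> 1" "g1 ` {0..t} \<subseteq> T" "g2 ` {0..t} \<subseteq> T"
    by (rule arc_interior_two_germs[OF st T(2) ai[OF x]])
  \<comment> \<open>\<open>t\<close> may be 1, the tip of the arm; \<open>t/2\<close> is an inner
    parameter, as \<open>mem\<close> requires.\<close>
  have "g1 (t/2) \<in> T" "g2 (t/2) \<in> T" using g(4-7) by (auto simp: image_subset_iff)
  then have "{g1, g2} \<subseteq> A'" using mem[of g1 "t/2"] mem[of g2 "t/2"] g by auto
  moreover have finA': "finite A'" using D(1) by (simp add: A'_def)
  ultimately have c: "card A' \<ge> 2" using card_mono[of A' "{g1, g2}"] g(3) by simp
  have "\<exists>h h'. homeomorphism ?V (open_star (card A')) h h' \<and> h x = 0"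
  proof (rule star_homeomorphism[OF finA' refl])
    show "1 \<le> card A'" using c by simp
    show "arc g" "g 0 = x" if "g \<in> A'" for g using D(2,3) that by (auto simp: A'_def)
    show "g = h \<and> s = t \<or> s = 0 \<and> t = 0" if "g \<in> A'" "h \<in> A'" "s \<in> {0..1}" "t \<in> {0..1}" "g s = h t" for g h s t
      using D(5)[of g h s t] that by (simp add: A'_def)
  qed
  then show ?thesis unfolding star_like_interior_pt_def using x op c by blast
qed

lemma arc_continuous_inj_image:
  assumes "arc g" "continuous_on (path_image g) f" "inj_on f (path_image g)"
  shows "arc (f \<circ> g)"
proof -
  have g: "path g" "inj_on g {0..1}" using assms(1) by (auto simp: arc_def)
  show ?thesis unfolding arc_def
  proof
    show "path (f \<circ> g)" using path_continuous_image[OF g(1) assms(2)] .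
    show "inj_on (f \<circ> g) {0..1}" using comp_inj_on[OF g(2)] assms(3) by (simp add: path_image_def)
  qed
qed

text \<open>Two rays of the model star, joined at 0, are carried back by \<open>h'\<close>. They are
  cut at length 1/2 because tips at length 1 do not belong to \<open>open_star k\<close>.\<close>

lemma star_like_imp_arc_interior:
  assumes "star_like_interior_pt Z x"
  shows "arc_interior_pt Z x"
proof -
  obtain V k h h' where V: "openin (top_of_set Z) V" "x \<in> V" "k \<ge> 2" "homeomorphism V (open_star k) h h'" "h x = 0"
    using assms unfolding star_like_interior_pt_def by blast
  define g where "g = linepath (unit_root k 0 / 2) 0 +++ linepath 0 (unit_root k 1 / 2)"
  have ray: "closed_segment 0 (unit_root k j / 2) = (\<lambda>r. of_real r * unit_root k j) ` {0..1/2}" for j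
  proof -
    have "closed_segment 0 (unit_root k j / 2) = (\<lambda>u. of_real (u * (1/2)) * unit_root k j) ` {0..1}"
      unfolding closed_segment_image_interval by (simp add: scaleR_conv_of_real)
    also have "\<dots> = (\<lambda>r. of_real r * unit_root k j) ` (\<lambda>u. u * (1/2)) ` {0..1}" by (simp only: image_image)
    also have "(\<lambda>u::real. u * (1/2)) ` {0..1} = {0..1/2}" by simp
    finally show ?thesis .
  qed
  have "unit_root k j \<noteq> 0" for j by (simp add: unit_root_def)
  then have arcs: "arc (linepath (unit_root k 0 / 2) 0)" "arc (linepath 0 (unit_root k 1 / 2))" by auto
  have "closed_segment 0 (unit_root k 0 / 2) \<inter> closed_segment 0 (unit_root k 1 / 2) \<subseteq> {0}"
  proof
    fix z assume "z \<in> closed_segment 0 (unit_root k 0 / 2) \<inter> closed_segment 0 (unit_root k 1 / 2)"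
    then obtain r s where rs: "z = of_real r * unit_root k 0" "z = of_real s * unit_root k 1" "0 \<le> r" "0 \<le> s"
      unfolding ray by (elim IntE imageE) (metis atLeastAtMost_iff)
    have "r = 0" using ray_unique(2)[of r s 0 k 1] rs V(3) by force
    then show "z \<in> {0}" using rs by simp
  qed
  then have "arc g" unfolding g_def by (intro arc_join arcs) (auto simp: closed_segment_commute)
  have "path_image g = closed_segment 0 (unit_root k 0 / 2) \<union> closed_segment 0 (unit_root k 1 / 2)"
    unfolding g_def by (subst path_image_join) (auto simp: closed_segment_commute)
  also have "\<dots> \<subseteq> open_star k"
  proof -
    have k1: "1 \<le> k" using V(3) by simp
    have "(\<lambda>r. of_real r * unit_root k j) ` {0..1/2} \<subseteq> open_star k" if "j < k" for j
      using that V(3) unfolding open_star_rays[OF k1] by fastforce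
    then show ?thesis unfolding ray using V(3) by simp
  qed
  finally have gs: "path_image g \<subseteq> open_star k" .
  have h': "continuous_on (open_star k) h'" "inj_on h' (open_star k)" "h' ` open_star k = V"
    using V(4) by (auto simp: homeomorphism_def intro: inj_on_inverseI)
  have "arc (h' \<circ> g)" using \<open>arc g\<close> gs h'
    by (intro arc_continuous_inj_image) (auto intro: continuous_on_subset inj_on_subset)
  moreover have "path_image (h' \<circ> g) \<subseteq> Z"
    using gs h'(3) openin_imp_subset[OF V(1)] by (auto simp: path_image_def image_subset_iff)
  moreover have "x = (h' \<circ> g) (1/2)"
    using homeomorphism_apply1[OF V(4) V(2)] V(5) by (simp add: g_def joinpaths_def linepath_def)
  ultimately show ?thesis unfolding arc_interior_pt_def by (intro exI conjI) auto
qed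

subsection \<open>Edges and vertices\<close>

definition graph_edges :: "'a::metric_space set \<Rightarrow> (real \<Rightarrow> 'a) set \<Rightarrow> bool" where
  "graph_edges G A \<longleftrightarrow> finite A \<and> A \<noteq> {} \<and> (\<forall>g\<in>A. arc g) \<and> G = \<Union>(path_image ` A) \<and>
      (\<forall>g\<in>A. \<forall>h\<in>A. g \<noteq> h \<longrightarrow> path_image g \<inter> path_image h \<subseteq>
            {pathstart g, pathfinish g} \<inter> {pathstart h, pathfinish h})"

lemma is_graph_edges: "is_graph G \<longleftrightarrow> (\<exists>A. graph_edges G A)"
  unfolding is_graph_def graph_edges_def ..

definition vertices :: "(real \<Rightarrow> 'a::metric_space) set \<Rightarrow> 'a set" where
  "vertices A = pathstart ` A \<union> pathfinish ` A"

lemma graph_edgesD: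
  assumes "graph_edges G A"
  shows "finite A" "e \<in> A \<Longrightarrow> arc e" "e \<in> A \<Longrightarrow> path_image e \<subseteq> G" "x \<in> G \<Longrightarrow> \<exists>e\<in>A. x \<in> path_image e"
    "e \<in> A \<Longrightarrow> h \<in> A \<Longrightarrow> e \<noteq> h \<Longrightarrow> x \<in> path_image e \<Longrightarrow> x \<in> path_image h \<Longrightarrow> x \<in> {e 0, e 1} \<and> x \<in> {h 0, h 1}"
    "A \<noteq> {}"
proof -
  note G = assms[unfolded graph_edges_def pathstart_def pathfinish_def]
  show "finite A" "A \<noteq> {}" "e \<in> A \<Longrightarrow> arc e" using G by auto
  show "path_image e \<subseteq> G" if "e \<in> A" using G that by auto
  show "\<exists>e\<in>A. x \<in> path_image e" if "x \<in> G" using G that by auto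
  assume "e \<in> A" "h \<in> A" "e \<noteq> h" "x \<in> path_image e" "x \<in> path_image h"
  moreover from this have "path_image e \<inter> path_image h \<subseteq> {e 0, e 1} \<inter> {h 0, h 1}" using G by simp
  ultimately show "x \<in> {e 0, e 1} \<and> x \<in> {h 0, h 1}" by blast
qed

lemma graph_compact: "graph_edges G A \<Longrightarrow> compact G"
  unfolding graph_edges_def by (auto intro!: compact_UN compact_arc_image)

text \<open>The open edge is what remains of \<open>G\<close> after removing a compact set: its two
  ends and all other edges.\<close>

lemma edge_free:
  assumes G: "graph_edges G A" and e: "e \<in> A"
  shows "free_arc G e"
proof -
  note D = graph_edgesD[OF G]
  let ?K = "{e 0, e 1} \<union> (\<Union>h\<in>A-{e}. path_image h)"
  have "compact ?K" using D(1,2) by (intro compact_Un compact_UN) (auto simp: compact_arc_image)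
  then have "openin (top_of_set G) (G - ?K)" by (intro openin_diff_compact openin_subtopology_self)
  moreover have "G - ?K = e ` {0<..<1}"
  proof
    show "G - ?K \<subseteq> e ` {0<..<1}"
    proof
      fix y assume y: "y \<in> G - ?K"
      then obtain h where "h \<in> A" "y \<in> path_image h" using D(4) by blast
      then have "y \<in> path_image e" using y by auto
      then obtain s where s: "s \<in> {0..1}" "y = e s" by (auto simp: path_image_def)
      then have "s \<noteq> 0" "s \<noteq> 1" using y by auto
      then show "y \<in> e ` {0<..<1}" using s by auto
    qed
    show "e ` {0<..<1} \<subseteq> G - ?K"
    proof
      fix y assume "y \<in> e ` {0<..<1}"
      then obtain s where s: "0 < s" "s < 1" "y = e s" by auto
      have ye: "y \<in> path_image e" using s by (auto simp: path_image_def)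
      have n: "y \<notin> {e 0, e 1}"
        using arc_inj[OF D(2)[OF e], of s 0] arc_inj[OF D(2)[OF e], of s 1] s by auto
      moreover have "y \<notin> path_image h" if "h \<in> A - {e}" for h
        using D(5)[OF e, of h y] that ye n by auto
      ultimately show "y \<in> G - ?K" using ye D(3)[OF e] by blast
    qed
  qed
  ultimately show ?thesis using D(2,3)[OF e] by (simp add: free_arc_def)
qed

definition from_vertex :: "'a::metric_space \<Rightarrow> (real \<Rightarrow> 'a) \<Rightarrow> real \<Rightarrow> 'a" where
  "from_vertex v e = (if pathstart e = v then e else reversepath e)"

lemma from_vertex:
  assumes "arc e" "v \<in> {e 0, e 1}"
  shows "arc (from_vertex v e)" "from_vertex v e 0 = v" "path_image (from_vertex v e) = path_image e"
    "{v, from_vertex v e 1} = {e 0, e 1}" "from_vertex v e ` {0<..<1} = e ` {0<..<1}"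
proof -
  show "arc (from_vertex v e)" "path_image (from_vertex v e) = path_image e"
    using assms by (auto simp: from_vertex_def arc_reversepath)
  show "from_vertex v e 0 = v" "{v, from_vertex v e 1} = {e 0, e 1}"
    using assms by (auto simp: from_vertex_def reversepath_def pathstart_def)
  have "(\<lambda>x. 1 - x) ` {0<..<1::real} = {0<..<1}"
  proof -
    have "y \<in> (\<lambda>x. 1 - x) ` {0<..<1}" if "y \<in> {0<..<1::real}" for y
      using that by (intro image_eqI[of _ _ "1 - y"]) auto
    then show ?thesis by auto
  qed
  then have "reversepath e ` {0<..<1} = e ` {0<..<1}" unfolding reversepath_def by (metis image_image)
  then show "from_vertex v e ` {0<..<1} = e ` {0<..<1}" by (simp add: from_vertex_def)
qed

text \<open>Edges are cut in half because two edges may share both end-points.\<close>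

lemma vertex_star:
  assumes G: "graph_edges G A" and v: "v \<in> vertices A"
  shows "star_at G v ((\<lambda>e. segpath (from_vertex v e) 0 (1/2)) ` {e \<in> A. v \<in> {e 0, e 1}})"
proof -
  note D = graph_edgesD[OF G]
  define E where "E = {e \<in> A. v \<in> {e 0, e 1}}"
  define o' where "o' = from_vertex v"
  have EA: "e \<in> A" "v \<in> {e 0, e 1}" if "e \<in> E" for e using that by (auto simp: E_def)
  have o: "arc (o' e)" "o' e 0 = v" "path_image (o' e) = path_image e" "{v, o' e 1} = {e 0, e 1}" if "e \<in> E" for e
    using from_vertex[OF D(2)[OF EA(1)[OF that]] EA(2)[OF that]] by (auto simp: o'_def)
  have im: "path_image (segpath (o' e) 0 (1/2)) = o' e ` {0..1/2}" for e
    by (simp add: path_image_segpath closed_segment_eq_real_ivl)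
  have half: "segpath (o' e) 0 (1/2) ` {0..<1} = o' e ` {0..<1/2}" for e
  proof -
    have "(\<lambda>t. 0 + (1/2 - 0) * t) ` {0..<1::real} = {0..<1/2}"
    proof -
      have "y \<in> (\<lambda>t. 0 + (1/2 - 0) * t) ` {0..<1}" if "y \<in> {0..<1/2::real}" for y
        using that by (intro image_eqI[of _ _ "2 * y"]) auto
      then show ?thesis by auto
    qed
    then show ?thesis unfolding segpath_def by (metis image_image)
  qed
  have sub: "o' e s \<in> path_image e" if "e \<in> E" "s \<in> {0..1}" for e s
    using o(3)[OF that(1)] that(2) by (auto simp: path_image_def)
  \<comment> \<open>In the half next to \<open>v\<close>, the only point shared with another edge is
    \<open>v\<close> itself, since the far end of \<open>e\<close> lies in the other half.\<close>
  have near: "s = 0" if "e \<in> E" "s \<in> {0..1/2}" "h \<in> A" "h \<noteq> e" "o' e s \<in> path_image h" for e s h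
  proof -
    have "o' e s \<in> {e 0, e 1}" using D(5)[OF EA(1)[OF that(1)] that(3)] sub[OF that(1)] that by auto
    then have "o' e s = o' e 0 \<or> o' e s = o' e 1" using o(2,4)[OF that(1)] by auto
    then have "s = 0 \<or> s = 1" using arc_inj[OF o(1)[OF that(1)], of s 0] arc_inj[OF o(1)[OF that(1)], of s 1] that(2) by auto
    then show ?thesis using that(2) by auto
  qed
  have subG: "o' e ` {0..1/2} \<subseteq> G" if "e \<in> E" for e
  proof -
    have "o' e ` {0..1/2} \<subseteq> path_image (o' e)" unfolding path_image_def by (rule image_mono) auto
    then show ?thesis using o(3)[OF that] D(3)[OF EA(1)[OF that]] by auto
  qed
  define N where "N = insert v (\<Union>e\<in>E. o' e ` {0..<1/2})"
  define K where "K = (\<Union>e\<in>A-E. path_image e) \<union> (\<Union>e\<in>E. o' e ` {1/2..1})"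
  obtain e0 where e0: "e0 \<in> E" using v unfolding vertices_def E_def pathstart_def pathfinish_def by auto
  have vK: "v \<notin> K"
  proof
    assume "v \<in> K"
    then consider h where "h \<in> A" "h \<notin> E" "v \<in> path_image h" | h s where "h \<in> E" "s \<in> {1/2..1}" "v = o' h s"
      unfolding K_def by auto
    then show False
    proof cases
      case 1
      have "v \<in> path_image e0" using sub[OF e0, of 0] o(2)[OF e0] by simp
      then have "v \<in> {h 0, h 1}" using D(5)[OF EA(1)[OF e0] 1(1), of v] 1 e0 by auto
      then show False using 1 by (simp add: E_def)
    next
      case 2
      then show False using o(2)[OF 2(1)] arc_inj[OF o(1)[OF 2(1)], of s 0] by auto
    qed
  qed
  \<comment> \<open>The star is open as the complement of a compact set: the edges not at
    \<open>v\<close> and the far halves of the edges at \<open>v\<close>.\<close>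
  have NK: "N = G - K"
  proof
    show "N \<subseteq> G - K"
    proof
      fix y assume y: "y \<in> N"
      show "y \<in> G - K"
      proof (cases "y = v")
        case True
        then show ?thesis using vK subG[OF e0] o(2)[OF e0] by force
      next
        case False
        then obtain e s where es: "e \<in> E" "0 \<le> s" "s < 1/2" "y = o' e s" using y by (auto simp: N_def)
        have "s \<noteq> 0" using False es o(2) by auto
        have "y \<in> G" using subG[OF es(1)] es by auto
        moreover have "y \<notin> path_image h" if "h \<in> A" "h \<noteq> e" for h
          using near[OF es(1) _ that, of s] es \<open>s \<noteq> 0\<close> by auto
        moreover have "y \<notin> o' h ` {1/2..1}" if h: "h \<in> E" for h
        proof (cases "h = e")
          case True
          show ?thesis
          proof
            assume "y \<in> o' h ` {1/2..1}"
            then obtain r where "r \<in> {1/2..1}" "o' e s = o' e r" using True es(4) by auto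
            then show False using arc_inj[OF o(1)[OF es(1)], of s r] es by auto
          qed
        next
          case F: False
          have "o' h ` {1/2..1} \<subseteq> path_image (o' h)" unfolding path_image_def by (rule image_mono) auto
          then have "o' h ` {1/2..1} \<subseteq> path_image h" using o(3)[OF h] by simp
          moreover have "y \<notin> path_image h" using near[OF es(1) _ EA(1)[OF h] F, of s] es \<open>s \<noteq> 0\<close> by auto
          ultimately show ?thesis by blast
        qed
        ultimately show ?thesis unfolding K_def using es(1) by blast
      qed
    qed
    show "G - K \<subseteq> N"
    proof
      fix y assume y: "y \<in> G - K"
      then obtain e where e: "e \<in> A" "y \<in> path_image e" using D(4) by blast
      then have "e \<in> E" using y by (auto simp: K_def)
      then have "y \<in> path_image (o' e)" using e o(3) by simp
      then obtain s where s: "s \<in> {0..1}" "y = o' e s" unfolding path_image_def by blast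
      have "\<not> s \<ge> 1/2" using y s \<open>e \<in> E\<close> by (auto simp: K_def)
      then have "y \<in> o' e ` {0..<1/2}" using s by auto
      then show "y \<in> N" using \<open>e \<in> E\<close> by (auto simp: N_def)
    qed
  qed
  have finE: "finite E" using D(1) by (simp add: E_def)
  have "compact (\<Union>e\<in>A-E. path_image e)" using D(1,2) by (intro compact_UN) (auto simp: compact_arc_image)
  moreover have "compact (\<Union>e\<in>E. o' e ` {1/2..1})"
    by (intro compact_UN finE arc_compact_image o(1)) auto
  ultimately have "compact K" unfolding K_def by (rule compact_Un)
  then have opN: "openin (top_of_set G) N" unfolding NK by (intro openin_diff_compact openin_subtopology_self)
  have Neq: "insert v (\<Union>g\<in>(\<lambda>e. segpath (o' e) 0 (1/2)) ` E. g ` {0..<1}) = N"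
    unfolding N_def using half by simp
  have pw: "path_image (segpath (o' e) 0 (1/2)) \<inter> path_image (segpath (o' h) 0 (1/2)) = {v}"
    if eh: "e \<in> E" "h \<in> E" "e \<noteq> h" for e h
  proof
    show "path_image (segpath (o' e) 0 (1/2)) \<inter> path_image (segpath (o' h) 0 (1/2)) \<subseteq> {v}"
    proof
      fix y assume "y \<in> path_image (segpath (o' e) 0 (1/2)) \<inter> path_image (segpath (o' h) 0 (1/2))"
      then obtain s t where st: "s \<in> {0..1/2}" "t \<in> {0..1/2}" "y = o' e s" "y = o' h t" unfolding im by blast
      have "s = 0" using near[OF eh(1) st(1) EA(1)[OF eh(2)]] sub[OF eh(2), of t] st eh(3) by auto
      then show "y \<in> {v}" using st o(2)[OF eh(1)] by simp
    qed
    have "v \<in> o' e ` {0..1/2}" "v \<in> o' h ` {0..1/2}"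
      using o(2)[OF eh(1)] o(2)[OF eh(2)] by (auto intro!: image_eqI[of _ _ 0])
    then show "{v} \<subseteq> path_image (segpath (o' e) 0 (1/2)) \<inter> path_image (segpath (o' h) 0 (1/2))"
      unfolding im by blast
  qed
  have arm: "arc (segpath (o' e) 0 (1/2)) \<and> pathstart (segpath (o' e) 0 (1/2)) = v \<and>
      path_image (segpath (o' e) 0 (1/2)) \<subseteq> G" if "e \<in> E" for e
    using arc_segpath[OF o(1)[OF that], of 0 "1/2"] o(2)[OF that] subG[OF that] by (simp add: im)
  have "star_at G v ((\<lambda>e. segpath (o' e) 0 (1/2)) ` E)"
    unfolding star_at_def Neq
  proof (intro conjI opN finite_imageI finE)
    show "\<forall>g\<in>(\<lambda>e. segpath (o' e) 0 (1/2)) ` E. arc g \<and> pathstart g = v \<and> path_image g \<subseteq> G"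
      using arm by blast
    show "\<forall>g\<in>(\<lambda>e. segpath (o' e) 0 (1/2)) ` E. \<forall>h\<in>(\<lambda>e. segpath (o' e) 0 (1/2)) ` E.
        g \<noteq> h \<longrightarrow> path_image g \<inter> path_image h = {v}"
      using pw by blast
  qed
  then show ?thesis by (simp add: E_def o'_def)
qed

lemma graph_point_cases:
  assumes G: "graph_edges G A" and x: "x \<in> G"
  obtains "x \<in> vertices A" | e u where "e \<in> A" "0 < u" "u < 1" "x = e u"
proof -
  obtain e where e: "e \<in> A" "x \<in> path_image e" using graph_edgesD(4)[OF G x] by blast
  then obtain u where u: "u \<in> {0..1}" "x = e u" by (auto simp: path_image_def)
  consider "u = 0" | "u = 1" | "0 < u" "u < 1" using u(1) by fastforce
  then show thesis
  proof cases
    case 1 then show ?thesis using that(1) e u by (auto simp: vertices_def pathstart_def)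
  next
    case 2 then show ?thesis using that(1) e u by (auto simp: vertices_def pathfinish_def)
  next
    case 3 then show ?thesis using that(2) e u by blast
  qed
qed

lemma graph_star:
  assumes G: "graph_edges G A" and x: "x \<in> G"
  obtains S where "star_at G x S"
  using G x
proof (cases rule: graph_point_cases)
  case 1 then show ?thesis using vertex_star[OF G] that by blast
next
  case (2 e u) then show ?thesis using free_star(1)[OF edge_free[OF G]] that by blast
qed

text \<open>At its starting point the arc contains a germ of a star arm, and arms are free arcs.
  This turns an arc in a fibre into an open subset of the graph, the kind of set that
  \<open>generic\<close> speaks about.\<close>

lemma graph_arc_interior:
  assumes G: "graph_edges G A" and b: "arc b" "path_image b \<subseteq> G"
  obtains W where "openin (top_of_set G) W" "W \<noteq> {}" "W \<subseteq> path_image b"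
proof -
  have b0: "b 0 \<in> path_image b" "b 1 \<in> path_image b" by (auto simp: path_image_def)
  then have "b 0 \<in> G" using b by blast
  then obtain S where S: "star_at G (b 0) S" by (rule graph_star[OF G])
  have "b 1 \<noteq> b 0" using arc_inj[OF b(1), of 1 0] by auto
  then have "path_image b \<noteq> {b 0}" using b0 by auto
  then obtain g t where g: "g \<in> S" "0 < t" "t \<le> 1" "g ` {0..t} \<subseteq> path_image b"
    using connected_contains_germ[OF S b(2) connected_arc_image[OF b(1)] b0(1)] by blast
  have "openin (top_of_set G) (g ` {0<..<t})" using free_subarc_open[OF star_free[OF S g(1)]] g by simp
  moreover have "g (t/2) \<in> g ` {0<..<t}" using g by auto
  moreover have "g ` {0<..<t} \<subseteq> g ` {0..t}" by (rule image_mono) auto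
  ultimately show thesis using that g(4) by (metis empty_iff order_trans)
qed

text \<open>The family consists of the rational subintervals of the edges. Its countability is what
  the Baire argument in \<open>generic_base\<close> relies on.\<close>

lemma graph_countable_pi_base:
  assumes G: "graph_edges G A"
  obtains \<J> where "countable \<J>" "\<And>J. J \<in> \<J> \<Longrightarrow> \<exists>q. free_arc G q \<and> J = q ` {0<..<1}"
    "\<And>W. openin (top_of_set G) W \<Longrightarrow> W \<noteq> {} \<Longrightarrow> \<exists>J\<in>\<J>. J \<subseteq> W"
proof -
  note D = graph_edgesD[OF G]
  define I where "I = {(e, a, b). e \<in> A \<and> a \<in> \<rat> \<and> b \<in> \<rat> \<and> 0 \<le> a \<and> a < b \<and> b \<le> (1::real)}"
  define \<J> where "\<J> = (\<lambda>(e, a, b). e ` {a<..<b}) ` I"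
  have "I \<subseteq> A \<times> \<rat> \<times> \<rat>" by (auto simp: I_def)
  then have "countable I" using D(1) by (meson countable_SIGMA countable_finite countable_rat countable_subset)
  then have "countable \<J>" by (simp add: \<J>_def)
  moreover have "\<exists>q. free_arc G q \<and> J = q ` {0<..<1}" if "J \<in> \<J>" for J
  proof -
    obtain e a b where e: "e \<in> A" "0 \<le> a" "a < b" "b \<le> 1" "J = e ` {a<..<b}"
      using \<open>J \<in> \<J>\<close> unfolding \<J>_def I_def by blast
    then show ?thesis using free_arc_segpath[OF edge_free[OF G e(1)] e(2-4)] segpath_image_open[OF e(2-4), of e]
      by (intro exI[of _ "segpath e a b"]) simp
  qed
  moreover have "\<exists>J\<in>\<J>. J \<subseteq> W" if W: "openin (top_of_set G) W" "W \<noteq> {}" for W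
  proof -
    obtain y where y: "y \<in> W" using W(2) by blast
    then have "y \<in> G" using openin_imp_subset[OF W(1)] by blast
    then obtain e where e: "e \<in> A" "y \<in> path_image e" using D(4) by blast
    then obtain s where s: "s \<in> {0..1}" "y = e s" by (auto simp: path_image_def)
    have "continuous_on {0..1} e" "e ` {0..1} \<subseteq> G"
      using D(2,3)[OF e(1)] by (auto simp: arc_def path_def path_image_def)
    then have "openin (top_of_set {0..1}) ({0..1} \<inter> e -` W)"
      using W(1) by (meson continuous_openin_preimage image_subset_iff_funcset)
    then obtain d where d: "d > 0" "ball s d \<inter> {0..1} \<subseteq> {0..1} \<inter> e -` W"
      using s y unfolding openin_contains_ball by blast
    \<comment> \<open>The point \<open>y\<close> may be an end of its edge, so the interval is cut
      down to the unit interval before rational ends are chosen.\<close>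
    have "max 0 (s - d) < min 1 (s + d)" using s(1) d(1) by auto
    then obtain a where a: "a \<in> \<rat>" "max 0 (s - d) < a" "a < min 1 (s + d)" using Rats_dense_in_real by blast
    then obtain b where b: "b \<in> \<rat>" "a < b" "b < min 1 (s + d)" using Rats_dense_in_real by blast
    have "{a<..<b} \<subseteq> ball s d \<inter> {0..1}" using a b by (auto simp: dist_real_def)
    then have "e ` {a<..<b} \<subseteq> W" using d(2) by blast
    moreover have "(e, a, b) \<in> I" using a b e by (auto simp: I_def)
    ultimately show ?thesis unfolding \<J>_def by (intro bexI[of _ "e ` {a<..<b}"]) force+
  qed
  ultimately show thesis by (rule that)
qed

section \<open>Closed subsets of a graph with only arc-interior points\<close>

lemma full_edge:
  assumes G: "graph_edges G A" and T: "closed T" "T \<subseteq> G" and ai: "\<And>y. y \<in> T \<Longrightarrow> arc_interior_pt T y"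
    and e: "e \<in> A" "0 < u" "u < 1" "e u \<in> T"
  shows "path_image e \<subseteq> T"
proof -
  have "e u \<in> e ` {0<..<1} \<inter> T" using e by auto
  then show ?thesis using free_arc_dichotomy[OF edge_free[OF G e(1)] T ai] by blast
qed

text \<open>By \<open>full_edge\<close> such a \<open>T\<close> is the union of the edges and the
  vertices that it contains, so it is determined by a set of edges and a set of vertices.\<close>

lemma finitely_many_arc_interior_sets:
  assumes G: "graph_edges G A"
  shows "finite {T. closed T \<and> T \<subseteq> G \<and> (\<forall>y\<in>T. arc_interior_pt T y)}"
proof (rule finite_subset)
  let ?V = "vertices A"
  show "{T. closed T \<and> T \<subseteq> G \<and> (\<forall>y\<in>T. arc_interior_pt T y)} \<subseteq>
      (\<lambda>(S, V). \<Union>(path_image ` S) \<union> V) ` (Pow A \<times> Pow ?V)"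
  proof clarify
    fix T assume T: "closed T" "T \<subseteq> G" "\<forall>y\<in>T. arc_interior_pt T y"
    define S where "S = {e \<in> A. path_image e \<subseteq> T}"
    have "T \<subseteq> \<Union>(path_image ` S) \<union> (T \<inter> ?V)"
    proof
      fix y assume y: "y \<in> T"
      have "y \<in> G" using y T by blast
      with G show "y \<in> \<Union>(path_image ` S) \<union> (T \<inter> ?V)"
      proof (cases rule: graph_point_cases)
        case (2 e u)
        then have "path_image e \<subseteq> T" using full_edge[OF G T(1,2)] T(3) y by blast
        moreover have "y \<in> path_image e" using 2 by (auto simp: path_image_def)
        ultimately show ?thesis using 2(1) by (auto simp: S_def)
      qed (use y in auto)
    qed
    moreover have "\<Union>(path_image ` S) \<union> (T \<inter> ?V) \<subseteq> T" by (auto simp: S_def)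
    ultimately have "T = (\<lambda>(S, V). \<Union>(path_image ` S) \<union> V) (S, T \<inter> ?V)"
      unfolding prod.case by (rule subset_antisym)
    moreover have "(S, T \<inter> ?V) \<in> Pow A \<times> Pow ?V" by (auto simp: S_def)
    ultimately show "T \<in> (\<lambda>(S, V). \<Union>(path_image ` S) \<union> V) ` (Pow A \<times> Pow ?V)" by (rule image_eqI)
  qed
  show "finite ((\<lambda>(S, V). \<Union>(path_image ` S) \<union> V) ` (Pow A \<times> Pow ?V))"
    using graph_edgesD(1)[OF G] by (auto simp: vertices_def)
qed

text \<open>Each of the two germs in \<open>T\<close> at \<open>v\<close> spreads to its whole edge
  by \<open>full_edge\<close>. Different arms come from different edges, because an edge, being an
  arc, leaves \<open>v\<close> only once.\<close>

lemma two_edges_at_vertex: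
  assumes G: "graph_edges G A" and T: "closed T" "T \<subseteq> G" and ai: "\<And>y. y \<in> T \<Longrightarrow> arc_interior_pt T y"
    and v: "v \<in> vertices A" "v \<in> T"
  obtains e1 e2 where "e1 \<in> A" "e2 \<in> A" "e1 \<noteq> e2" "v \<in> {e1 0, e1 1}" "v \<in> {e2 0, e2 1}"
    "path_image e1 \<subseteq> T" "path_image e2 \<subseteq> T"
proof -
  note D = graph_edgesD[OF G]
  let ?E = "{e \<in> A. v \<in> {e 0, e 1}}" and ?g = "\<lambda>e. segpath (from_vertex v e) 0 (1/2)"
  obtain g1 g2 t where g: "g1 \<in> ?g ` ?E" "g2 \<in> ?g ` ?E" "g1 \<noteq> g2" "0 < t" "t \<le> 1"
    "g1 ` {0..t} \<subseteq> T" "g2 ` {0..t} \<subseteq> T"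
    by (rule arc_interior_two_germs[OF vertex_star[OF G v(1)] T(2) ai[OF v(2)]])
  obtain e1 e2 where e: "e1 \<in> ?E" "g1 = ?g e1" "e2 \<in> ?E" "g2 = ?g e2" using g(1,2) by blast
  have full: "path_image e \<subseteq> T" if "e \<in> ?E" "?g e ` {0..t} \<subseteq> T" for e
  proof -
    have eA: "e \<in> A" "v \<in> {e 0, e 1}" using that by auto
    have "?g e t \<in> T" using that(2) g(4) by (auto simp: image_subset_iff)
    moreover have "?g e t = from_vertex v e (t/2)" by (simp add: segpath_def)
    moreover have "from_vertex v e (t/2) \<in> from_vertex v e ` {0<..<1}" using g(4,5) by auto
    ultimately obtain u where "0 < u" "u < 1" "e u \<in> T"
      using from_vertex(5)[OF D(2)[OF eA(1)] eA(2)] by auto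
    then show ?thesis using full_edge[OF G T ai eA(1)] by blast
  qed
  show thesis
  proof (rule that[of e1 e2])
    show "e1 \<noteq> e2" using e g(3) by blast
    show "path_image e1 \<subseteq> T" "path_image e2 \<subseteq> T" using full e g by blast+
  qed (use e in auto)
qed

text \<open>A longest arc composed of edges in \<open>T\<close> cannot be prolonged at its end, so the second edge
  in \<open>T\<close> at that vertex leads back to the arc.\<close>

lemma arc_interior_set_contains_circle:
  assumes G: "graph_edges G A" and T: "closed T" "T \<subseteq> G" "T \<noteq> {}" and ai: "\<And>y. y \<in> T \<Longrightarrow> arc_interior_pt T y"
  obtains C where "C \<subseteq> T" "is_circle C"
proof -
  note D = graph_edgesD[OF G]
  define S where "S = {e \<in> A. path_image e \<subseteq> T}"
  \<comment> \<open>\<open>S'\<close> collects the edges traversed. The last clause says that the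
    end of \<open>\<sigma>\<close> lies on a single traversed edge \<open>e0\<close>, so any other
    edge of \<open>S\<close> at that vertex is new. The number of edges is bounded by
    \<open>card A\<close> and can be maximised.\<close>
  define P where "P = (\<lambda>(\<sigma>, S'). arc \<sigma> \<and> S' \<subseteq> S \<and> path_image \<sigma> = \<Union>(path_image ` S') \<and>
     (\<exists>e0\<in>S'. \<sigma> 1 \<in> {e0 0, e0 1} \<and> (\<forall>e\<in>S'. \<sigma> 1 \<in> path_image e \<longrightarrow> e = e0)))"
  obtain x where x: "x \<in> T" using T(3) by blast
  then have "x \<in> G" using T(2) by blast
  with G have "\<exists>e. e \<in> S"
  proof (cases rule: graph_point_cases)
    case 1
    then show ?thesis using two_edges_at_vertex[OF G T(1,2) ai 1 x] unfolding S_def by blast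
  next
    case (2 e u)
    then show ?thesis using full_edge[OF G T(1,2) ai] x unfolding S_def by blast
  qed
  then obtain e where e: "e \<in> S" by blast
  then have "P (e, {e})" using D(2) by (auto simp: P_def S_def)
  moreover have bound: "(card \<circ> snd) q < Suc (card A)" if "P q" for q
  proof -
    obtain \<sigma> S' where q: "q = (\<sigma>, S')" by fastforce
    then have "S' \<subseteq> A" using that by (auto simp: P_def S_def)
    then show ?thesis using card_mono[OF D(1)] q by (simp add: less_Suc_eq_le)
  qed
  ultimately obtain q where q: "P q" "\<And>q'. P q' \<Longrightarrow> (card \<circ> snd) q' \<le> (card \<circ> snd) q"
    using ex_has_greatest_nat[of P "(e, {e})" "card \<circ> snd" "Suc (card A)"] by (metis less_imp_le)
  obtain \<sigma> S' where "q = (\<sigma>, S')" by fastforce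
  with q(1) have "P (\<sigma>, S')" by simp
  then obtain e0 where \<sigma>: "arc \<sigma>" "S' \<subseteq> S" "path_image \<sigma> = \<Union>(path_image ` S')"
    and e0: "e0 \<in> S'" "\<sigma> 1 \<in> {e0 0, e0 1}" "\<And>e. e \<in> S' \<Longrightarrow> \<sigma> 1 \<in> path_image e \<Longrightarrow> e = e0"
    unfolding P_def by blast
  have max: "card S'' \<le> card S'" if "P (\<tau>, S'')" for \<tau> S''
    using q(2)[OF that] \<open>q = (\<sigma>, S')\<close> by simp
  define v where "v = \<sigma> 1"
  have vT: "v \<in> T"
  proof -
    have "v \<in> path_image e0" using e0(2) by (auto simp: v_def path_image_def)
    then show ?thesis using e0(1) \<sigma>(2) by (auto simp: S_def)
  qed
  have "v \<in> vertices A"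
    using e0(1,2) \<sigma>(2) unfolding v_def vertices_def S_def pathstart_def pathfinish_def by blast
  then obtain e1 e2 where ee: "e1 \<in> A" "e2 \<in> A" "e1 \<noteq> e2" "v \<in> {e1 0, e1 1}" "v \<in> {e2 0, e2 1}"
    "path_image e1 \<subseteq> T" "path_image e2 \<subseteq> T"
    using vT two_edges_at_vertex[OF G T(1,2) ai] by metis
  obtain e where e: "e \<in> S" "v \<in> {e 0, e 1}" "e \<noteq> e0"
  proof (cases "e1 = e0")
    case True then show ?thesis using that[of e2] ee by (auto simp: S_def)
  next
    case False then show ?thesis using that[of e1] ee by (auto simp: S_def)
  qed
  have eA: "e \<in> A" using e(1) by (simp add: S_def)
  have ve: "v \<in> path_image e" using e(2) by (auto simp: path_image_def)
  then have eS': "e \<notin> S'" using e0(3) e(3) by (auto simp: v_def)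
  define o' where "o' = from_vertex v e"
  have o: "arc o'" "o' 0 = v" "path_image o' = path_image e" "{v, o' 1} = {e 0, e 1}"
    using from_vertex[OF D(2)[OF eA] e(2)] by (auto simp: o'_def)
  have wv: "o' 1 \<noteq> v" using arc_inj[OF o(1), of 1 0] o(2) by auto
  have we: "o' 1 \<in> {e 0, e 1}" using o(4) by blast
  have inter: "y \<in> {v, o' 1}" if y: "y \<in> path_image \<sigma>" "y \<in> path_image o'" for y
  proof -
    obtain h where h: "h \<in> S'" "y \<in> path_image h" using y(1) \<sigma>(3) by auto
    then have "h \<in> A" "h \<noteq> e" using \<sigma>(2) eS' by (auto simp: S_def)
    then have "y \<in> {e 0, e 1}" using D(5)[OF eA, of h y] h y(2) o(3) by auto
    then show ?thesis using o(4) by simp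
  qed
  \<comment> \<open>Otherwise appending \<open>e\<close> would give an arc with one more edge that
    still satisfies \<open>P\<close>.\<close>
  have "o' 1 \<in> path_image \<sigma>"
  proof (rule ccontr)
    assume w: "o' 1 \<notin> path_image \<sigma>"
    have "arc (\<sigma> +++ o')"
      by (rule arc_join[OF \<sigma>(1) o(1)]) (use o(2) inter w in \<open>auto simp: v_def pathstart_def pathfinish_def\<close>)
    moreover have "path_image (\<sigma> +++ o') = \<Union>(path_image ` insert e S')"
      by (subst path_image_join) (use o(2,3) \<sigma>(3) in \<open>auto simp: v_def pathstart_def pathfinish_def\<close>)
    moreover have "(\<sigma> +++ o') 1 = o' 1" by (simp add: joinpaths_def)
    moreover have "h = e" if "h \<in> insert e S'" "o' 1 \<in> path_image h" for h
      using that w \<sigma>(3) by auto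
    ultimately have "P (\<sigma> +++ o', insert e S')"
      unfolding P_def using \<sigma>(2) e(1) we by auto
    then have "card (insert e S') \<le> card S'" by (rule max)
    moreover have "finite S'" using \<sigma>(2) D(1) by (auto simp: S_def intro: finite_subset)
    ultimately show False using eS' by simp
  qed
  then obtain u where u: "u \<in> {0..1}" "o' 1 = \<sigma> u" by (auto simp: path_image_def)
  then have "u \<noteq> 1" using wv by (auto simp: v_def)
  \<comment> \<open>The circle is the tail of \<open>\<sigma>\<close> from the far end of
    \<open>e\<close> to \<open>v\<close>, closed up by \<open>e\<close> itself.\<close>
  define c where "c = segpath \<sigma> u 1 +++ o'"
  have im: "path_image (segpath \<sigma> u 1) \<subseteq> path_image \<sigma>"
    using \<open>u \<noteq> 1\<close> u(1) segment_in_unit[of u 1] unfolding path_image_def[of \<sigma>]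
    by (subst path_image_segpath) auto
  have ends: "pathfinish (segpath \<sigma> u 1) = pathstart o'" "pathfinish o' = pathstart (segpath \<sigma> u 1)"
    using u(2) o(2) by (auto simp: pathstart_def[of o'] pathfinish_def[of o'] v_def)
  have "simple_path c" unfolding c_def
  proof (rule simple_path_join_loop[OF _ o(1) ends])
    show "arc (segpath \<sigma> u 1)" using \<sigma>(1) u(1) \<open>u \<noteq> 1\<close> by (intro arc_segpath) auto
    have "pathstart o' = v" "pathstart (segpath \<sigma> u 1) = o' 1" using o(2) u(2) by (auto simp: pathstart_def[of o'])
    then show "path_image (segpath \<sigma> u 1) \<inter> path_image o' \<subseteq> {pathstart (segpath \<sigma> u 1), pathstart o'}"
      using inter im by auto
  qed
  moreover have "pathfinish c = pathstart c" using ends by (simp add: c_def)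
  ultimately have "is_circle (path_image c)"
    unfolding is_circle_def by (rule homeomorphic_simple_path_image_circle) simp
  moreover have "path_image c \<subseteq> T"
  proof -
    have "path_image c = path_image (segpath \<sigma> u 1) \<union> path_image o'"
      unfolding c_def using ends by (simp add: path_image_join)
    moreover have "path_image \<sigma> \<subseteq> T" using \<sigma>(2,3) by (auto simp: S_def)
    moreover have "path_image o' \<subseteq> T" using o(3) e(1) by (simp add: S_def)
    ultimately show ?thesis using im by blast
  qed
  ultimately show thesis using that by blast
qed

section \<open>Transport by homeomorphisms, and almost injectivity\<close>

lemma arc_interior_pt_homeomorphism:
  assumes h: "homeomorphism Z T a b" and x: "arc_interior_pt Z x"
  shows "arc_interior_pt T (a x)"
proof -
  obtain g where g: "arc g" "path_image g \<subseteq> Z" "x \<in> g ` {0<..<1}" using x by (auto simp: arc_interior_pt_def)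
  have a: "continuous_on Z a" "inj_on a Z" "a ` Z = T"
    using h by (auto simp: homeomorphism_def intro: inj_on_inverseI)
  have "arc (a \<circ> g)"
    by (rule arc_continuous_inj_image[OF g(1) continuous_on_subset[OF a(1) g(2)] inj_on_subset[OF a(2) g(2)]])
  moreover have "path_image (a \<circ> g) \<subseteq> T" using g(2) a(3) by (auto simp: path_image_compose)
  moreover have "a x \<in> (a \<circ> g) ` {0<..<1}" using g(3) by auto
  ultimately show ?thesis unfolding arc_interior_pt_def by blast
qed

lemma star_like_homeomorphism:
  assumes h: "homeomorphism Z T a b" and x: "x \<in> Z" "star_like_interior_pt T (a x)"
  shows "star_like_interior_pt Z x"
proof -
  obtain V k u u' where V: "openin (top_of_set T) V" "a x \<in> V" "k \<ge> 2" "homeomorphism V (open_star k) u u'" "u (a x) = 0"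
    using x(2) unfolding star_like_interior_pt_def by blast
  have VT: "V \<subseteq> T" using V(1) openin_imp_subset by blast
  have a: "continuous_on Z a" "a ` Z = T" using h by (auto simp: homeomorphism_def)
  have "openin (top_of_set Z) (Z \<inter> a -` V)"
    by (rule continuous_openin_preimage[OF a(1) _ V(1)]) (use a in auto)
  moreover have "homeomorphism (Z \<inter> a -` V) V a b"
    by (rule homeomorphism_of_subsets[OF h]) (use a VT in auto)
  then have "homeomorphism (Z \<inter> a -` V) (open_star k) (u \<circ> a) (b \<circ> u')"
    using homeomorphism_compose V(4) by blast
  moreover have "x \<in> Z \<inter> a -` V" "(u \<circ> a) x = 0" using V x by auto
  ultimately show ?thesis unfolding star_like_interior_pt_def using x(1) V(3) by blast
qed

text \<open>A point of this set shares its image only with points closer than \<open>\<epsilon>\<close>; the form of the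
  definition makes the set open, and irreducibility of minimal maps makes it dense.\<close>

definition almost_inj_pts :: "'a::metric_space set \<Rightarrow> ('a \<Rightarrow> 'a) \<Rightarrow> real \<Rightarrow> 'a set" where
  "almost_inj_pts X f \<epsilon> = (\<Union>W\<in>{W. openin (top_of_set X) W \<and> (\<forall>x\<in>W. \<forall>y\<in>W. dist x y < \<epsilon>)}.
      X \<inter> f -` (X - f ` (X - W)))"

lemma almost_inj_pts_mono: "\<delta> \<le> \<epsilon> \<Longrightarrow> almost_inj_pts X f \<delta> \<subseteq> almost_inj_pts X f \<epsilon>"
  unfolding almost_inj_pts_def by (intro UN_mono) force+

lemma almost_inj_ptsD:
  assumes "x \<in> almost_inj_pts X f \<epsilon>" "y \<in> X" "f x = f y"
  shows "dist x y < \<epsilon>"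
proof -
  obtain W where W: "\<forall>x\<in>W. \<forall>y\<in>W. dist x y < \<epsilon>" "x \<in> X" "f x \<notin> f ` (X - W)"
    using assms(1) by (auto simp: almost_inj_pts_def)
  then have "x \<in> W" by blast
  moreover have "y \<in> W"
  proof (rule ccontr)
    assume "y \<notin> W"
    then have "f y \<in> f ` (X - W)" using assms(2) by blast
    then show False using W(3) assms(3) by simp
  qed
  ultimately have "x \<in> W" "y \<in> W" .
  then show ?thesis using W(1) by blast
qed

lemma almost_inj_pts_open_dense:
  fixes f :: "'a::metric_space \<Rightarrow> 'a"
  assumes X: "compact X" and f: "continuous_on X f" "f ` X \<subseteq> X" "minimal_on X f" and \<epsilon>: "\<epsilon> > 0"
  shows "openin (top_of_set X) (almost_inj_pts X f \<epsilon>)"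
    and "openin (top_of_set X) W \<Longrightarrow> W \<noteq> {} \<Longrightarrow> W \<inter> almost_inj_pts X f \<epsilon> \<noteq> {}"
proof -
  have clo: "closedin (top_of_set X) (f ` (X - W))" if "openin (top_of_set X) W" for W
    by (rule compact_image_closedin[OF X f(1,2) closedin_self_diff[OF that]])
  show "openin (top_of_set X) (almost_inj_pts X f \<epsilon>)" unfolding almost_inj_pts_def
  proof (rule openin_Union, clarify)
    fix W assume W: "openin (top_of_set X) W"
    show "openin (top_of_set X) (X \<inter> f -` (X - f ` (X - W)))"
      by (rule continuous_openin_preimage[OF f(1) _ openin_self_diff[OF clo[OF W]]]) (use f(2) in auto)
  qed
  assume W: "openin (top_of_set X) W" "W \<noteq> {}"
  then obtain x where x: "x \<in> W" by blast
  \<comment> \<open>Radius \<open>\<epsilon>/2\<close> makes any two points of \<open>W'\<close>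
    closer than \<open>\<epsilon>\<close>, so \<open>W'\<close> can be the witness in
    \<open>almost_inj_pts\<close>.\<close>
  define W' where "W' = W \<inter> ball x (\<epsilon>/2)"
  have W': "openin (top_of_set X) W'" unfolding W'_def using W(1) by (simp add: openin_Int_open)
  have "x \<in> W'" using x \<epsilon> by (simp add: W'_def)
  then have ne: "X - f ` (X - W') \<noteq> {}" using minimal_irreducible(2)[OF X f W'] by blast
  have small: "dist y z < \<epsilon>" if "y \<in> W'" "z \<in> W'" for y z
    using that dist_triangle_half_r[of x y \<epsilon> z] by (auto simp: W'_def)
  obtain y where y: "y \<in> X" "y \<notin> f ` (X - W')" using ne by blast
  then obtain z where z: "z \<in> X" "y = f z" using minimal_surj[OF X f] by blast
  then have "z \<in> W'" using y by blast
  moreover have "z \<in> almost_inj_pts X f \<epsilon>" unfolding almost_inj_pts_def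
    using W' small y z by (intro UN_I[of W']) auto
  ultimately show "W \<inter> almost_inj_pts X f \<epsilon> \<noteq> {}" by (auto simp: W'_def)
qed

section \<open>Minimal sets in graph bundles\<close>

locale bundle_system =
  fixes E :: "'e::metric_space set" and B :: "'b::metric_space set" and p :: "'e \<Rightarrow> 'b"
    and \<Gamma> :: "'g::metric_space set" and F :: "'e \<Rightarrow> 'e" and f :: "'b \<Rightarrow> 'b" and M :: "'e set"
  assumes cgb: "compact_graph_bndl E B p \<Gamma>"
    and F_cont: "continuous_on E F" and F_maps: "F ` E \<subseteq> E"
    and f_cont: "continuous_on B f" and f_maps: "f ` B \<subseteq> B"
    and comm: "\<forall>x\<in>E. p (F x) = f (p x)"
    and f_min: "minimal_on B f"
    and M_min: "minimal_set E F M"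
    and M_onto: "p ` M = B"
begin

lemma E_compact: "compact E" and B_compact: "compact B" and p_cont: "continuous_on E p" and p_onto: "p ` E = B"
  using cgb by (auto simp: compact_graph_bndl_def)

lemma M_closedin: "closedin (top_of_set E) M" and M_ne: "M \<noteq> {}" and M_inv: "F ` M \<subseteq> M" and F_minimal: "minimal_on M F"
  using M_min by (auto simp: minimal_set_def)

lemma M_sub: "M \<subseteq> E" using M_closedin closedin_imp_subset by blast

lemma M_compact: "compact M" using closedin_compact[OF E_compact M_closedin] .

lemma F_cont_M: "continuous_on M F" using continuous_on_subset[OF F_cont M_sub] .

lemma p_cont_M: "continuous_on M p" using continuous_on_subset[OF p_cont M_sub] .

lemma comm_M: "x \<in> M \<Longrightarrow> p (F x) = f (p x)" using comm M_sub by blast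

lemmas F_sys = M_compact F_cont_M M_inv F_minimal
lemmas f_sys = B_compact f_cont f_maps f_min

lemma p_semiopen:
  assumes "openin (top_of_set M) W" "W \<noteq> {}"
  shows "\<exists>V. openin (top_of_set B) V \<and> V \<noteq> {} \<and> V \<subseteq> p ` W"
  using minimal_factor_semiopen[OF F_sys f_sys p_cont_M M_onto comm_M assms] .

lemma edges: obtains A where "graph_edges \<Gamma> A"
  using cgb by (auto simp: compact_graph_bndl_def is_graph_edges)

lemma \<Gamma>_closed: "closed \<Gamma>"
  using edges graph_compact compact_imp_closed by metis

section \<open>Charts, and fibres of \<open>M\<close> read in the graph\<close>

definition chart :: "'b set \<Rightarrow> ('e \<Rightarrow> 'b \<times> 'g) \<Rightarrow> ('b \<times> 'g \<Rightarrow> 'e) \<Rightarrow> bool" where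
  "chart U h k \<longleftrightarrow> openin (top_of_set B) U \<and> homeomorphism (E \<inter> p -` U) (U \<times> \<Gamma>) h k \<and>
     (\<forall>x\<in>E \<inter> p -` U. fst (h x) = p x)"

lemma chart_ex: "b \<in> B \<Longrightarrow> \<exists>U h k. chart U h k \<and> b \<in> U"
  using cgb unfolding compact_graph_bndl_def chart_def by blast

text \<open>Reading the fibre of \<open>M\<close> inside the fixed graph \<open>\<Gamma>\<close>
  makes fibres over different base points comparable; the final argument uses that they can be one
  and the same set.\<close>

definition fib :: "('b \<times> 'g \<Rightarrow> 'e) \<Rightarrow> 'b \<Rightarrow> 'g set" where
  "fib k b = {g \<in> \<Gamma>. k (b, g) \<in> M}"

definition M_fibre :: "'b \<Rightarrow> 'e set" where "M_fibre b = M \<inter> E \<inter> p -` {b}"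

lemma chartD:
  assumes "chart U h k"
  shows "openin (top_of_set B) U" "homeomorphism (E \<inter> p -` U) (U \<times> \<Gamma>) h k"
    "\<And>x. x \<in> E \<Longrightarrow> p x \<in> U \<Longrightarrow> fst (h x) = p x" "U \<subseteq> B"
  using assms openin_imp_subset unfolding chart_def by auto

lemma chart_apply:
  assumes c: "chart U h k" and b: "b \<in> U" and g: "g \<in> \<Gamma>"
  shows "k (b, g) \<in> E" "p (k (b, g)) = b" "h (k (b, g)) = (b, g)"
proof -
  have bg: "(b, g) \<in> U \<times> \<Gamma>" using b g by simp
  have kk: "k (b, g) \<in> E \<inter> p -` U" using chartD(2)[OF c] bg unfolding homeomorphism_def by blast
  then show "k (b, g) \<in> E" by simp
  show hk: "h (k (b, g)) = (b, g)" using homeomorphism_apply2[OF chartD(2)[OF c] bg] .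
  show "p (k (b, g)) = b" using chartD(3)[OF c, of "k (b, g)"] kk hk by simp
qed

lemma chart_inverse:
  assumes c: "chart U h k" and x: "x \<in> E" "p x \<in> U"
  shows "snd (h x) \<in> \<Gamma>" "k (p x, snd (h x)) = x" "h x = (p x, snd (h x))"
proof -
  have xx: "x \<in> E \<inter> p -` U" using x by simp
  then have "h x \<in> U \<times> \<Gamma>" using chartD(2)[OF c] unfolding homeomorphism_def by blast
  then show "snd (h x) \<in> \<Gamma>" by auto
  show e: "h x = (p x, snd (h x))" using chartD(3)[OF c x] by (metis prod.collapse)
  show "k (p x, snd (h x)) = x" using homeomorphism_apply1[OF chartD(2)[OF c] xx] e by simp
qed

lemma chart_cont:
  assumes c: "chart U h k"
  shows "continuous_on (U \<times> \<Gamma>) k" "continuous_on (E \<inter> p -` U) h"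
  using chartD(2)[OF c] by (auto simp: homeomorphism_def)

lemma chart_cont_fibre:
  assumes c: "chart U h k" and b: "b \<in> U"
  shows "continuous_on \<Gamma> (\<lambda>g. k (b, g))"
  by (rule continuous_on_compose2[OF chart_cont(1)[OF c]]) (use b in \<open>auto intro!: continuous_intros\<close>)

lemma chart_open:
  assumes c: "chart U h k" and U': "openin (top_of_set B) U'" "U' \<subseteq> U" and V: "openin (top_of_set \<Gamma>) V"
  shows "openin (top_of_set E) (k ` (U' \<times> V))"
proof -
  have "openin (top_of_set U) U'" using U' chartD(4)[OF c] by (metis openin_subset_trans)
  then have "openin (top_of_set (U \<times> \<Gamma>)) (U' \<times> V)" using V by (simp add: openin_Times)
  then have "openin (top_of_set (E \<inter> p -` U)) (k ` (U' \<times> V))"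
    using homeomorphism_imp_open_map[OF homeomorphism_symD[OF chartD(2)[OF c]]] by blast
  moreover have "openin (top_of_set E) (E \<inter> p -` U)"
    by (rule continuous_openin_preimage[OF p_cont _ chartD(1)[OF c]]) (use p_onto in auto)
  ultimately show ?thesis by (rule openin_trans)
qed

lemma fib_closed:
  assumes c: "chart U h k" and b: "b \<in> U"
  shows "closed (fib k b)" "fib k b \<subseteq> \<Gamma>"
proof -
  have "closedin (top_of_set \<Gamma>) (\<Gamma> \<inter> (\<lambda>g. k (b, g)) -` M)"
    using chart_cont_fibre[OF c b] compact_imp_closed[OF M_compact] by (rule continuous_closedin_preimage)
  moreover have "\<Gamma> \<inter> (\<lambda>g. k (b, g)) -` M = fib k b" by (auto simp: fib_def)
  ultimately show "closed (fib k b)" using \<Gamma>_closed closedin_closed_trans by metis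
  show "fib k b \<subseteq> \<Gamma>" by (auto simp: fib_def)
qed

lemma fib_homeomorphism:
  assumes c: "chart U h k" and b: "b \<in> U"
  shows "homeomorphism (M_fibre b) (fib k b) (snd \<circ> h) (\<lambda>g. k (b, g))"
proof (rule homeomorphismI)
  have sub: "M_fibre b \<subseteq> E \<inter> p -` U" using b by (auto simp: M_fibre_def)
  show "continuous_on (M_fibre b) (snd \<circ> h)"
    by (rule continuous_on_compose[OF continuous_on_subset[OF chart_cont(2)[OF c] sub]]) (intro continuous_intros)
  show "continuous_on (fib k b) (\<lambda>g. k (b, g))"
    using continuous_on_subset[OF chart_cont_fibre[OF c b] fib_closed(2)[OF c b]] .
  have inv: "snd (h x) \<in> \<Gamma>" "k (b, snd (h x)) = x" if "x \<in> M_fibre b" for x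
    using chart_inverse[OF c, of x] that b by (auto simp: M_fibre_def)
  show "(snd \<circ> h) ` M_fibre b \<subseteq> fib k b" using inv by (auto simp: fib_def M_fibre_def)
  show "(\<lambda>g. k (b, g)) ` fib k b \<subseteq> M_fibre b" using chart_apply[OF c b] by (auto simp: fib_def M_fibre_def)
  show "k (b, (snd \<circ> h) x) = x" if "x \<in> M_fibre b" for x using inv that by simp
  show "(snd \<circ> h) (k (b, g)) = g" if "g \<in> fib k b" for g using chart_apply[OF c b] that by (auto simp: fib_def)
qed

lemma fib_arc_interior:
  assumes c: "chart U h k" and b: "b \<in> U" and g: "g \<in> fib k b"
  shows "arc_interior_pt (M_fibre b) (k (b, g)) \<longleftrightarrow> arc_interior_pt (fib k b) g"
proof
  assume "arc_interior_pt (M_fibre b) (k (b, g))"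
  then show "arc_interior_pt (fib k b) g"
    using arc_interior_pt_homeomorphism[OF fib_homeomorphism[OF c b]] chart_apply(3)[OF c b] g
    by (fastforce simp: fib_def)
next
  assume "arc_interior_pt (fib k b) g"
  then show "arc_interior_pt (M_fibre b) (k (b, g))"
    using arc_interior_pt_homeomorphism[OF homeomorphism_symD[OF fib_homeomorphism[OF c b]]] by blast
qed

section \<open>Open sets without end-points\<close>

lemma End_of_eq: "End_of E B p M = {x \<in> M. \<not> star_like_interior_pt (M_fibre (p x)) x}"
  using M_onto M_sub unfolding End_of_def end_points_def M_fibre_def by auto

lemma interior_if_misses_End:
  assumes W: "openin (top_of_set M) W" "W \<noteq> {}" "W \<inter> End_of E B p M = {}"
  shows "\<exists>V. openin (top_of_set E) V \<and> V \<noteq> {} \<and> V \<subseteq> M"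
proof -
  have WM: "W \<subseteq> M" using W(1) openin_imp_subset by blast
  obtain W' where W': "open W'" "W = M \<inter> W'" using W(1) by (auto simp: openin_open)
  obtain x where x: "x \<in> W" using W(2) by blast
  define b where "b = p x"
  have "b \<in> B" using x WM M_onto by (auto simp: b_def)
  then obtain U h k where c: "chart U h k" "b \<in> U" using chart_ex by blast
  obtain A where A: "graph_edges \<Gamma> A" by (rule edges)
  have ai: "arc_interior_pt (M_fibre (p y)) y" if "y \<in> W" for y
    using that W(3) WM star_like_imp_arc_interior unfolding End_of_eq by blast
  define g0 where "g0 = snd (h x)"
  have xE: "x \<in> E" "p x \<in> U" using x WM M_sub c(2) by (auto simp: b_def)
  have g0: "g0 \<in> \<Gamma>" "k (b, g0) = x" using chart_inverse[OF c(1) xE] by (auto simp: g0_def b_def)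
  then have g0f: "g0 \<in> fib k b" using x WM by (auto simp: fib_def)
  have "arc_interior_pt (fib k b) g0"
    using fib_arc_interior[OF c g0f] ai[OF x] g0(2) by (simp add: b_def)
  moreover obtain S where S: "star_at \<Gamma> g0 S" by (rule graph_star[OF A g0(1)])
  ultimately obtain g t where g: "g \<in> S" "0 < t" "t \<le> 1" "g ` {0..t} \<subseteq> fib k b"
    using arc_interior_two_germs[OF S fib_closed(2)[OF c]] by metis
  note SD = star_atD[OF S]
  have fg: "free_arc \<Gamma> g" using star_free[OF S g(1)] .
  have gcont: "continuous_on {0..1} g" "g ` {0..1} \<subseteq> \<Gamma>"
    using fg by (auto simp: free_arc_def arc_def path_def path_image_def)
  have kop: "openin (top_of_set (U \<times> \<Gamma>)) ((U \<times> \<Gamma>) \<inter> k -` W')"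
    using continuous_openin_preimage_gen[OF chart_cont(1)[OF c(1)] W'(1)] .
  \<comment> \<open>\<open>x\<close> itself may be a ramification point. The argument moves a little
    along a germ to \<open>g u\<close>, which lies inside a free arc and still in the fibre and in
    \<open>W'\<close>.\<close>
  obtain u where u: "0 < u" "u < 1" "u \<le> t" "k (b, g u) \<in> W'"
  proof -
    have cont: "continuous_on {0..1} (\<lambda>s. k (b, g s))"
      by (rule continuous_on_compose2[OF chart_cont_fibre[OF c] gcont])
    have "openin (top_of_set {0..1}) ({0..1} \<inter> (\<lambda>s. k (b, g s)) -` W')"
      using continuous_openin_preimage_gen[OF cont W'(1)] .
    moreover have "0 \<in> {0..1} \<inter> (\<lambda>s. k (b, g s)) -` W'" using SD(3)[OF g(1)] g0(2) x W'(2) by auto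
    ultimately obtain d where d: "d > 0" "ball 0 d \<inter> {0..1} \<subseteq> {0..1} \<inter> (\<lambda>s. k (b, g s)) -` W'"
      unfolding openin_contains_ball by blast
    define u where "u = min (min t (d/2)) (1/2)"
    have "0 < u" "u < 1" "u \<le> t" "u < d" using g d(1) by (auto simp: u_def min_def)
    moreover from this have "u \<in> ball 0 d \<inter> {0..1}" by auto
    ultimately show thesis using that d(2) by blast
  qed
  have gu: "g u \<in> fib k b" "g u \<in> \<Gamma>" using g(4) u gcont(2) by auto
  have "(b, g u) \<in> (U \<times> \<Gamma>) \<inter> k -` W'" using c(2) gu u by auto
  then obtain U' V' where UV: "openin (top_of_set U) U'" "openin (top_of_set \<Gamma>) V'" "b \<in> U'" "g u \<in> V'"
     "U' \<times> V' \<subseteq> (U \<times> \<Gamma>) \<inter> k -` W'"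
    using kop by (rule Times_in_interior_subtopology)
  have U'B: "openin (top_of_set B) U'" "U' \<subseteq> U"
    using openin_trans[OF UV(1) chartD(1)[OF c(1)]] openin_imp_subset[OF UV(1)] by auto
  obtain a a' where a: "0 \<le> a" "a < u" "u < a'" "a' \<le> 1" "g ` {a<..<a'} \<subseteq> V'"
  proof -
    have "openin (top_of_set {0..1}) ({0..1} \<inter> g -` V')"
      by (rule continuous_openin_preimage[OF gcont(1) _ UV(2)]) (use gcont(2) in auto)
    moreover have "u \<in> {0..1} \<inter> g -` V'" using u UV(4) by auto
    ultimately obtain d where d: "d > 0" "ball u d \<inter> {0..1} \<subseteq> {0..1} \<inter> g -` V'"
      unfolding openin_contains_ball by blast
    have "{max 0 (u - d)<..<min 1 (u + d)} \<subseteq> ball u d \<inter> {0..1}" by (auto simp: dist_real_def)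
    then have "g ` {max 0 (u - d)<..<min 1 (u + d)} \<subseteq> V'" using d(2) by blast
    then show thesis using that[of "max 0 (u - d)" "min 1 (u + d)"] u d(1) by auto
  qed
  define q where "q = segpath g a a'"
  have fq: "free_arc \<Gamma> q" unfolding q_def using free_arc_segpath[OF fg] a by simp
  have qi: "q ` {0<..<1} = g ` {a<..<a'}" unfolding q_def using a by (intro segpath_image_open) auto
  have qopen: "openin (top_of_set \<Gamma>) (q ` {0<..<1})" using fq by (simp add: free_arc_def)
  \<comment> \<open>Inside the box every point of \<open>M\<close> belongs to \<open>W\<close> and
    is thus arc-interior in its fibre, so \<open>free_arc_dichotomy\<close> applies over every
    \<open>b'\<close> in \<open>U'\<close>.\<close>
  have dich: "path_image q \<subseteq> fib k b'" if b': "b' \<in> U'" "y \<in> q ` {0<..<1}" "y \<in> fib k b'" for b' y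
  proof -
    have b'U: "b' \<in> U" using U'B b' by auto
    have "arc_interior_pt (fib k b') z" if z: "z \<in> fib k b'" "z \<in> q ` {0<..<1}" for z
    proof -
      have "(b', z) \<in> U' \<times> V'" using b'(1) z(2) a(5) qi by auto
      then have "k (b', z) \<in> W'" using UV(5) by blast
      then have "k (b', z) \<in> W" using z(1) W'(2) by (simp add: fib_def)
      moreover have "p (k (b', z)) = b'" using chart_apply(2)[OF c(1) b'U] z(1) by (simp add: fib_def)
      ultimately have "arc_interior_pt (M_fibre b') (k (b', z))" using ai by metis
      then show ?thesis using fib_arc_interior[OF c(1) b'U z(1)] by simp
    qed
    then show ?thesis using free_arc_dichotomy[OF fq fib_closed[OF c(1) b'U]] b'(2,3) by blast
  qed
  define W2 where "W2 = M \<inter> k ` (U' \<times> q ` {0<..<1})"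
  have "openin (top_of_set M) W2" unfolding W2_def
    using openin_restrict[OF chart_open[OF c(1) U'B qopen] M_sub] .
  moreover have "k (b, g u) \<in> W2"
  proof -
    have "(b, g u) \<in> U' \<times> q ` {0<..<1}" using UV(3) a qi by auto
    then show ?thesis using gu(1) unfolding W2_def fib_def by blast
  qed
  \<comment> \<open>Base points below \<open>W2\<close> are those whose fibre is met by the open arc
    of \<open>q\<close> and therefore contains it; semi-openness yields an open set of them.\<close>
  ultimately obtain V where V: "openin (top_of_set B) V" "V \<noteq> {}" "V \<subseteq> p ` W2" using p_semiopen by blast
  have VU: "b' \<in> U' \<and> path_image q \<subseteq> fib k b'" if b'V: "b' \<in> V" for b'
  proof -
    obtain z where "z \<in> W2" "b' = p z" using V(3) b'V by blast
    then obtain b2 y where z: "k (b2, y) \<in> M" "b2 \<in> U'" "y \<in> q ` {0<..<1}" "b' = p (k (b2, y))"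
      unfolding W2_def by blast
    have y: "y \<in> \<Gamma>" using z(3) openin_imp_subset[OF qopen] by blast
    then have "b' = b2" using chart_apply(2)[OF c(1)] z U'B(2) by auto
    then show ?thesis using dich z y by (auto simp: fib_def)
  qed
  have "V \<subseteq> U" using VU U'B(2) by blast
  then have "openin (top_of_set E) (k ` (V \<times> q ` {0<..<1}))" using chart_open[OF c(1) V(1) _ qopen] by blast
  moreover have "k ` (V \<times> q ` {0<..<1}) \<subseteq> M"
  proof -
    have "q ` {0<..<1} \<subseteq> path_image q" by (auto simp: path_image_def)
    then show ?thesis using VU unfolding fib_def by blast
  qed
  moreover have "k ` (V \<times> q ` {0<..<1}) \<noteq> {}" using V(2) by auto
  ultimately show ?thesis by blast
qed

end

text \<open>Only the open arc is known to lie in \<open>Z\<close>, so a closed subarc around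
  \<open>y\<close> is used instead.\<close>

lemma arc_interior_pt_arcI:
  assumes q: "arc q" "q ` {0<..<1} \<subseteq> Z" and y: "y \<in> q ` {0<..<1}"
  shows "arc_interior_pt Z y"
proof -
  obtain u where u: "0 < u" "u < 1" "y = q u" using y by auto
  have "path_image (segpath q (u/2) ((1 + u)/2)) = q ` {u/2..(1 + u)/2}"
    using u by (subst path_image_segpath) (auto simp: closed_segment_eq_real_ivl)
  also have "\<dots> \<subseteq> q ` {0<..<1}" using u by (intro image_mono) auto
  finally have "path_image (segpath q (u/2) ((1 + u)/2)) \<subseteq> Z" using q(2) by blast
  moreover have "arc (segpath q (u/2) ((1 + u)/2))" using u by (intro arc_segpath q) auto
  moreover have "segpath q (u/2) ((1 + u)/2) ` {0<..<1} = q ` {u/2<..<(1 + u)/2}"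
    using u by (intro segpath_image_open) auto
  ultimately show ?thesis unfolding arc_interior_pt_def using u by (intro exI[of _ "segpath q (u/2) ((1 + u)/2)"]) auto
qed

section \<open>Generic base points\<close>

context bundle_system
begin

text \<open>Density of \<open>almost_inj_pts\<close> in \<open>M\<close> says nothing about a single
  fibre; \<open>generic\<close> asks for it on the open pieces inside the fibre. It is stated for
  some chart, so that \<open>generic_base\<close> can work with a finite cover by charts.\<close>

definition generic :: "'b \<Rightarrow> bool" where
  "generic b \<longleftrightarrow> (\<exists>U h k. chart U h k \<and> b \<in> U \<and>
     (\<forall>\<epsilon> J. \<epsilon> > 0 \<and> openin (top_of_set \<Gamma>) J \<and> J \<noteq> {} \<and> J \<subseteq> fib k b \<longrightarrow> (\<exists>g\<in>J. k (b, g) \<in> almost_inj_pts M F \<epsilon>)))"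

lemma openin_E_M: "openin (top_of_set E) V \<Longrightarrow> V \<subseteq> M \<Longrightarrow> openin (top_of_set M) V"
  using openin_restrict[of E V M] M_sub by (simp add: Int_absorb1)

text \<open>If the closure contained a nonempty open \<open>W\<close>, the box over
  \<open>W \<inter> U\<close> and \<open>J\<close> would be a nonempty open subset of
  \<open>M\<close> without almost injective points, against their density.\<close>

lemma closed_nowhere_dense_bad:
  assumes c: "chart U h k" and J: "openin (top_of_set \<Gamma>) J" "J \<noteq> {}" and \<epsilon>: "\<epsilon> > 0"
  shows "closed_nowhere_dense B (closure {b \<in> U. \<forall>g\<in>J. k (b, g) \<in> M - almost_inj_pts M F \<epsilon>})"
proof -
  define N where "N = M - almost_inj_pts M F \<epsilon>"
  define D where "D = {b \<in> U. \<forall>g\<in>J. k (b, g) \<in> N}"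
  note H = almost_inj_pts_open_dense[OF F_sys \<epsilon>]
  have JG: "J \<subseteq> \<Gamma>" using J(1) openin_imp_subset by blast
  have clN: "closed N" unfolding N_def
    using closedin_compact[OF M_compact closedin_self_diff[OF H(1)]] compact_imp_closed by blast
  have "D \<subseteq> B" using chartD(4)[OF c] by (auto simp: D_def)
  then have DB: "closure D \<subseteq> B" using B_compact by (simp add: closure_minimal compact_imp_closed)
  have "closedin (top_of_set U) (U \<inter> (\<lambda>b. k (b, g)) -` N)" if "g \<in> J" for g
  proof (rule continuous_closedin_preimage[OF _ clN])
    show "continuous_on U (\<lambda>b. k (b, g))"
      by (rule continuous_on_compose2[OF chart_cont(1)[OF c]]) (use that JG in \<open>auto intro!: continuous_intros\<close>)
  qed
  then have "closedin (top_of_set U) (\<Inter>g\<in>J. U \<inter> (\<lambda>b. k (b, g)) -` N)" using J(2) by (intro closedin_INT) auto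
  moreover have "(\<Inter>g\<in>J. U \<inter> (\<lambda>b. k (b, g)) -` N) = D" using J(2) by (auto simp: D_def)
  ultimately have "closedin (top_of_set U) D" by simp
  then obtain C where C: "closed C" "D = U \<inter> C" by (auto simp: closedin_closed)
  \<comment> \<open>\<open>D\<close> is closed only relative to \<open>U\<close>: taking the closure
    may add points, but none inside \<open>U\<close>.\<close>
  then have UD: "U \<inter> closure D \<subseteq> D" using closure_minimal[of D C] by auto
  have "W = {}" if W: "openin (top_of_set B) W" "W \<subseteq> closure D" for W
  proof (rule ccontr)
    assume "W \<noteq> {}"
    then obtain w where w: "w \<in> W" by blast
    obtain W0 where W0: "open W0" "W = B \<inter> W0" using W(1) by (auto simp: openin_open)
    have "w \<in> closure D" "w \<in> W0" using w W(2) W0(2) by auto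
    then have "W0 \<inter> D \<noteq> {}" using open_Int_closure_eq_empty[OF W0(1), of D] by blast
    then obtain b where b: "b \<in> W0" "b \<in> D" by blast
    then have bW: "b \<in> W \<inter> U" using W0(2) \<open>D \<subseteq> B\<close> by (auto simp: D_def)
    have "openin (top_of_set B) (W \<inter> U)" using W(1) chartD(1)[OF c] by (rule openin_Int)
    then have "openin (top_of_set E) (k ` ((W \<inter> U) \<times> J))" using chart_open[OF c _ _ J(1)] by blast
    moreover have sub: "k ` ((W \<inter> U) \<times> J) \<subseteq> N" using W(2) UD by (auto simp: D_def)
    ultimately have "openin (top_of_set M) (k ` ((W \<inter> U) \<times> J))"
      by (intro openin_E_M) (auto simp: N_def)
    moreover have "k ` ((W \<inter> U) \<times> J) \<noteq> {}" using bW J(2) by blast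
    ultimately have "k ` ((W \<inter> U) \<times> J) \<inter> almost_inj_pts M F \<epsilon> \<noteq> {}" by (rule H(2))
    then show False using sub by (auto simp: N_def)
  qed
  then have "closed_nowhere_dense B (closure D)" unfolding closed_nowhere_dense_def using DB by (simp add: closed_subset)
  then show ?thesis by (simp add: D_def N_def)
qed

text \<open>All forward images of the bad sets are removed: a point \<open>b\<close> in one of them
  has \<open>f b\<close> in the next, which gives backward invariance. The family stays countable,
  with finitely many charts, countably many arcs and the values \<open>1 / real (Suc n)\<close> for
  \<open>\<epsilon>\<close>.\<close>

lemma generic_base:
  obtains B0 where "B0 \<subseteq> B" "\<forall>W. openin (top_of_set B) W \<and> W \<noteq> {} \<longrightarrow> W \<inter> B0 \<noteq> {}"
    "\<forall>b\<in>B. f b \<in> B0 \<longrightarrow> b \<in> B0" "\<forall>b\<in>B0. generic b"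
proof -
  obtain A where A: "graph_edges \<Gamma> A" by (rule edges)
  obtain \<J> where \<J>: "countable \<J>" "\<And>J. J \<in> \<J> \<Longrightarrow> \<exists>q. free_arc \<Gamma> q \<and> J = q ` {0<..<1}"
    "\<And>W. openin (top_of_set \<Gamma>) W \<Longrightarrow> W \<noteq> {} \<Longrightarrow> \<exists>J\<in>\<J>. J \<subseteq> W"
    using graph_countable_pi_base[OF A] by metis
  have \<J>o: "openin (top_of_set \<Gamma>) J" "J \<noteq> {}" if "J \<in> \<J>" for J
    using \<J>(2)[OF that] by (auto simp: free_arc_def)
  obtain U h k where c: "\<And>b. b \<in> B \<Longrightarrow> chart (U b) (h b) (k b) \<and> b \<in> U b"
    using chart_ex by metis
  have op: "\<forall>V\<in>U ` B. openin (top_of_set B) V" using c chartD(1) by blast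
  have cov: "B \<subseteq> \<Union>(U ` B)" using c by blast
  obtain \<D> where \<D>: "\<D> \<subseteq> U ` B" "finite \<D>" "B \<subseteq> \<Union>\<D>"
    using B_compact op cov unfolding compact_eq_openin_cover by meson
  obtain I where I: "I \<subseteq> B" "finite I" "\<D> = U ` I" using finite_subset_image[OF \<D>(2,1)] by blast
  define bad where "bad i n J = {b \<in> U i. \<forall>g\<in>J. k i (b, g) \<in> M - almost_inj_pts M F (1 / real (Suc n))}" for i n J
  define \<G> where "\<G> = (\<lambda>(m, i, n, J). (f ^^ m) ` closure (bad i n J)) ` (UNIV \<times> I \<times> UNIV \<times> \<J>)"
  define B0 where "B0 = B - \<Union>\<G>"
  have mem: "(f ^^ m) ` closure (bad i n J) \<in> \<G>" if "i \<in> I" "J \<in> \<J>" for m i n J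
    unfolding \<G>_def using that by (intro image_eqI[of _ _ "(m, i, n, J)"]) auto
  have \<G>E: "\<exists>m i n J. i \<in> I \<and> J \<in> \<J> \<and> N = (f ^^ m) ` closure (bad i n J)" if "N \<in> \<G>" for N
    using that by (auto simp: \<G>_def)
  have closed_nowhere_dense: "closed_nowhere_dense B N" if N\<G>: "N \<in> \<G>" for N
  proof -
    obtain m i n J where N: "i \<in> I" "J \<in> \<J>" "N = (f ^^ m) ` closure (bad i n J)"
      using \<G>E[OF N\<G>] by blast
    have "chart (U i) (h i) (k i)" using c N(1) I(1) by blast
    then have "closed_nowhere_dense B (closure (bad i n J))" unfolding bad_def by (rule closed_nowhere_dense_bad) (use \<J>o[OF N(2)] in auto)
    then show ?thesis unfolding N(3) by (rule closed_nowhere_dense_funpow_image[OF f_sys])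
  qed
  have count: "countable \<G>" unfolding \<G>_def using \<J>(1) I(2)
    by (intro countable_image countable_SIGMA) (auto simp: countable_finite)
  show thesis
  proof (rule that[of B0]; (intro allI ballI impI)?)
    show "B0 \<subseteq> B" by (auto simp: B0_def)
    show "W \<inter> B0 \<noteq> {}" if "openin (top_of_set B) W \<and> W \<noteq> {}" for W
    proof
      have W: "openin (top_of_set B) W" "W \<noteq> {}" using that by auto
      assume "W \<inter> B0 = {}"
      then have "W \<subseteq> \<Union>\<G>" using openin_imp_subset[OF W(1)] unfolding B0_def by blast
      then show False using closed_nowhere_dense_countable_Union[OF B_compact count closed_nowhere_dense W(1)] W(2) by blast
    qed
    show "b \<in> B0" if b: "b \<in> B" "f b \<in> B0" for b
    proof (rule ccontr)
      assume "b \<notin> B0"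
      then have "b \<in> \<Union>\<G>" using b(1) by (simp add: B0_def)
      then obtain m i n J where N: "i \<in> I" "J \<in> \<J>" "b \<in> (f ^^ m) ` closure (bad i n J)"
        using \<G>E by blast
      then have "f b \<in> (f ^^ Suc m) ` closure (bad i n J)" by auto
      then show False using mem[OF N(1,2)] b(2) unfolding B0_def by blast
    qed
    show "generic b" if b: "b \<in> B0" for b
    proof -
      have "b \<in> B" using b by (simp add: B0_def)
      then obtain i where i: "i \<in> I" "b \<in> U i" using \<D>(3) I(3) by blast
      have ci: "chart (U i) (h i) (k i)" using c i(1) I(1) by blast
      have "\<exists>g\<in>J. k i (b, g) \<in> almost_inj_pts M F \<epsilon>"
        if J: "\<epsilon> > 0" "openin (top_of_set \<Gamma>) J" "J \<noteq> {}" "J \<subseteq> fib (k i) b" for \<epsilon> J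
      proof -
        obtain n where n: "1 / real (Suc n) < \<epsilon>" using nat_approx_posE[OF J(1)] by auto
        obtain J' where J': "J' \<in> \<J>" "J' \<subseteq> J" using \<J>(3)[OF J(2,3)] by blast
        \<comment> \<open>The images with exponent 0 exclude \<open>b\<close> itself from the bad
          sets.\<close>
        have "b \<notin> (f ^^ 0) ` closure (bad i n J')" using mem[OF i(1) J'(1)] b unfolding B0_def by blast
        then have "b \<notin> bad i n J'" using closure_subset by auto
        then obtain g where g: "g \<in> J'" "k i (b, g) \<notin> M - almost_inj_pts M F (1 / real (Suc n))"
          using i(2) unfolding bad_def by blast
        moreover have "k i (b, g) \<in> M" using g(1) J'(2) J(4) by (auto simp: fib_def)
        ultimately have "k i (b, g) \<in> almost_inj_pts M F (1 / real (Suc n))" by simp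
        then have "k i (b, g) \<in> almost_inj_pts M F \<epsilon>" using almost_inj_pts_mono[OF less_imp_le[OF n]] by (rule rev_subsetD)
        then show ?thesis using g(1) J'(2) by (intro bexI[of _ g]) auto
      qed
      then show ?thesis unfolding generic_def using ci i(2) by blast
    qed
  qed
qed

text \<open>Two half-arcs at \<open>y\<close> have images with different germs at \<open>F y\<close>: if both images contained
  the same germ, then \<open>F\<close> would be far from injective on an open piece of one of them.\<close>

lemma generic_preserves_arc_interior:
  assumes generic: "generic b" and y: "y \<in> M" "p y = b" "arc_interior_pt (M_fibre b) y"
  shows "arc_interior_pt (M_fibre (f b)) (F y)"
proof -
  obtain A where A: "graph_edges \<Gamma> A" by (rule edges)
  obtain U h k where c: "chart U h k" "b \<in> U"
    and gd': "\<forall>\<epsilon> J. \<epsilon> > 0 \<and> openin (top_of_set \<Gamma>) J \<and> J \<noteq> {} \<and> J \<subseteq> fib k b \<longrightarrow>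
      (\<exists>g\<in>J. k (b, g) \<in> almost_inj_pts M F \<epsilon>)"
    using generic unfolding generic_def by (elim exE conjE) (rule that)
  have gd: "\<exists>g\<in>J. k (b, g) \<in> almost_inj_pts M F \<epsilon>"
    if "\<epsilon> > 0" "openin (top_of_set \<Gamma>) J" "J \<noteq> {}" "J \<subseteq> fib k b" for \<epsilon> J
    using gd' that by blast
  have bB: "b \<in> B" using y M_onto by blast
  then have "f b \<in> B" using f_maps by blast
  then obtain U' h' k' where c': "chart U' h' k'" "f b \<in> U'" using chart_ex by blast
  define g0 where "g0 = snd (h y)"
  have yE: "y \<in> E" "p y \<in> U" using y M_sub c(2) by auto
  have g0: "g0 \<in> \<Gamma>" "k (b, g0) = y" using chart_inverse[OF c(1) yE] y(2) by (auto simp: g0_def)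
  then have g0f: "g0 \<in> fib k b" using y(1) by (simp add: fib_def)
  define \<phi> where "\<phi> g = snd (h' (F (k (b, g))))" for g
  have kM: "k (b, g) \<in> M" "p (k (b, g)) = b" "k (b, g) \<in> E" if "g \<in> fib k b" for g
    using that chart_apply[OF c] by (auto simp: fib_def)
  have FkE: "F (k (b, g)) \<in> M" "F (k (b, g)) \<in> E" "p (F (k (b, g))) = f b" if "g \<in> fib k b" for g
    using kM[OF that] M_inv M_sub comm_M by auto
  have F\<phi>: "k' (f b, \<phi> g) = F (k (b, g))" "\<phi> g \<in> \<Gamma>" if "g \<in> fib k b" for g
    using chart_inverse[OF c'(1) FkE(2)[OF that]] FkE(3)[OF that] c'(2) by (auto simp: \<phi>_def)
  have \<phi>f: "\<phi> g \<in> fib k' (f b)" if "g \<in> fib k b" for g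
    using F\<phi>[OF that] FkE(1)[OF that] by (simp add: fib_def)
  have \<phi>eq: "F (k (b, g)) = F (k (b, g'))" if "g \<in> fib k b" "g' \<in> fib k b" "\<phi> g = \<phi> g'" for g g'
    using F\<phi>(1)[OF that(1)] F\<phi>(1)[OF that(2)] that(3) by simp
  have kcont: "continuous_on (fib k b) (\<lambda>g. k (b, g))"
    using continuous_on_subset[OF chart_cont_fibre[OF c] fib_closed(2)[OF c]] .
  have \<phi>cont: "continuous_on (fib k b) \<phi>"
  proof -
    have "continuous_on (fib k b) (\<lambda>g. F (k (b, g)))"
      by (rule continuous_on_compose2[OF F_cont_M kcont]) (use kM in auto)
    then have "continuous_on (fib k b) (\<lambda>g. h' (F (k (b, g))))"
      by (rule continuous_on_compose2[OF chart_cont(2)[OF c'(1)]]) (use FkE c'(2) in auto)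
    then show ?thesis unfolding \<phi>_def by (rule continuous_on_snd)
  qed
  have kinj: "g = g'" if "g \<in> fib k b" "g' \<in> fib k b" "k (b, g) = k (b, g')" for g g'
  proof -
    have "g \<in> \<Gamma>" "g' \<in> \<Gamma>" using that(1,2) by (auto simp: fib_def)
    then have "(b, g) = h (k (b, g))" "(b, g') = h (k (b, g'))" using chart_apply(3)[OF c] by simp_all
    then have "(b, g) = (b, g')" using that(3) by metis
    then show ?thesis by simp
  qed
  \<comment> \<open>No arc is collapsed: a point of it that is injective up to \<open>d/2\<close>
    would be closer than \<open>d/2\<close> to both ends, which are \<open>d\<close> apart.\<close>
  have nonconst: "\<phi> ` path_image \<beta> \<noteq> {\<phi> (\<beta> 0)}" if \<beta>: "arc \<beta>" "path_image \<beta> \<subseteq> fib k b" for \<beta>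
  proof
    assume const: "\<phi> ` path_image \<beta> = {\<phi> (\<beta> 0)}"
    have ends: "\<beta> 0 \<in> path_image \<beta>" "\<beta> 1 \<in> path_image \<beta>" by (auto simp: path_image_def)
    define d where "d = dist (k (b, \<beta> 0)) (k (b, \<beta> 1))"
    have "\<beta> 0 \<noteq> \<beta> 1" using arc_inj[OF \<beta>(1), of 0 1] by auto
    then have "d > 0" using kinj[of "\<beta> 0" "\<beta> 1"] ends \<beta>(2) by (auto simp: d_def)
    obtain W where W: "openin (top_of_set \<Gamma>) W" "W \<noteq> {}" "W \<subseteq> path_image \<beta>"
      using graph_arc_interior[OF A \<beta>(1)] \<beta>(2) fib_closed(2)[OF c] by (metis order_trans)
    obtain g where g: "g \<in> W" "k (b, g) \<in> almost_inj_pts M F (d/2)"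
      using gd[of "d/2" W] \<open>d > 0\<close> W \<beta>(2) by auto
    have "dist (k (b, g)) (k (b, z)) < d/2" if "z \<in> path_image \<beta>" for z
    proof (rule almost_inj_ptsD[OF g(2)])
      have zf: "z \<in> fib k b" "g \<in> fib k b" using that \<beta>(2) g(1) W(3) by auto
      show "k (b, z) \<in> M" using kM zf by auto
      have "\<phi> g \<in> \<phi> ` path_image \<beta>" "\<phi> z \<in> \<phi> ` path_image \<beta>" using that g(1) W(3) by auto
      then have "\<phi> g = \<phi> z" unfolding const by simp
      then show "F (k (b, g)) = F (k (b, z))" by (rule \<phi>eq[OF zf(2,1)])
    qed
    then have "dist (k (b, g)) (k (b, \<beta> 0)) < d/2" "dist (k (b, g)) (k (b, \<beta> 1)) < d/2" using ends by auto
    then show False using dist_triangle_half_r[of "k (b, g)" "k (b, \<beta> 0)" d "k (b, \<beta> 1)"] by (simp add: d_def)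
  qed
  have "arc_interior_pt (fib k b) g0" using fib_arc_interior[OF c g0f] y(3) g0(2) by simp
  then obtain \<alpha> s where \<alpha>: "arc \<alpha>" "path_image \<alpha> \<subseteq> fib k b" "0 < s" "s < 1" "g0 = \<alpha> s"
    by (auto simp: arc_interior_pt_def)
  define \<beta>1 where "\<beta>1 = segpath \<alpha> s 0"
  define \<beta>2 where "\<beta>2 = segpath \<alpha> s 1"
  have arcs: "arc \<beta>1" "arc \<beta>2" unfolding \<beta>1_def \<beta>2_def using \<alpha> by (auto intro!: arc_segpath)
  have im: "path_image \<beta>1 = \<alpha> ` {0..s}" "path_image \<beta>2 = \<alpha> ` {s..1}"
    unfolding \<beta>1_def \<beta>2_def using \<alpha> by (auto simp: path_image_segpath closed_segment_eq_real_ivl)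
  have "\<alpha> ` {0..s} \<subseteq> path_image \<alpha>" "\<alpha> ` {s..1} \<subseteq> path_image \<alpha>"
    unfolding path_image_def using \<alpha> by (auto intro!: image_mono)
  then have sub: "path_image \<beta>1 \<subseteq> fib k b" "path_image \<beta>2 \<subseteq> fib k b" using \<alpha>(2) im by auto
  have start: "\<beta>1 0 = g0" "\<beta>2 0 = g0" using \<alpha>(5) by (auto simp: \<beta>1_def \<beta>2_def segpath_def)
  have "path_image \<beta>1 \<inter> path_image \<beta>2 = \<alpha> ` ({0..s} \<inter> {s..1})"
    unfolding im by (rule inj_on_image_Int[symmetric, of _ "{0..1}"]) (use \<alpha> in \<open>auto simp: arc_def\<close>)
  also have "{0..s} \<inter> {s..1} = {s}" using \<alpha> by auto
  finally have inter: "path_image \<beta>1 \<inter> path_image \<beta>2 = {g0}" using \<alpha>(5) by simp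
  define x' where "x' = \<phi> g0"
  have x'f: "x' \<in> fib k' (f b)" using \<phi>f[OF g0f] by (simp add: x'_def)
  then have x'G: "x' \<in> \<Gamma>" by (simp add: fib_def)
  obtain S where S: "star_at \<Gamma> x' S" by (rule graph_star[OF A x'G])
  note SD = star_atD[OF S]
  have Qf: "\<phi> ` path_image \<beta> \<subseteq> fib k' (f b)" if "path_image \<beta> \<subseteq> fib k b" for \<beta>
    using \<phi>f that by auto
  \<comment> \<open>The image of a half-arc is connected and, by \<open>nonconst\<close>, more than
    one point, so it contains a germ of an arm at \<open>x'\<close>.\<close>
  have germ: "\<exists>g\<in>S. \<exists>t. 0 < t \<and> t \<le> 1 \<and> g ` {0..t} \<subseteq> \<phi> ` path_image \<beta>"
    if \<beta>: "arc \<beta>" "path_image \<beta> \<subseteq> fib k b" "\<beta> 0 = g0" for \<beta>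
  proof (rule connected_contains_germ[OF S])
    show "\<phi> ` path_image \<beta> \<subseteq> \<Gamma>" using Qf[OF \<beta>(2)] by (auto simp: fib_def)
    show "connected (\<phi> ` path_image \<beta>)"
      by (rule connected_continuous_image[OF continuous_on_subset[OF \<phi>cont \<beta>(2)] connected_arc_image[OF \<beta>(1)]])
    have "g0 \<in> path_image \<beta>" using \<beta>(3) by (auto simp: path_image_def)
    then show "x' \<in> \<phi> ` path_image \<beta>" by (auto simp: x'_def)
    show "\<phi> ` path_image \<beta> \<noteq> {x'}" using nonconst[OF \<beta>(1,2)] \<beta>(3) by (simp add: x'_def)
  qed
  obtain g1 t1 where 1: "g1 \<in> S" "0 < t1" "t1 \<le> 1" "g1 ` {0..t1} \<subseteq> \<phi> ` path_image \<beta>1"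
    using germ[OF arcs(1) sub(1) start(1)] by blast
  obtain g2 t2 where 2: "g2 \<in> S" "0 < t2" "t2 \<le> 1" "g2 ` {0..t2} \<subseteq> \<phi> ` path_image \<beta>2"
    using germ[OF arcs(2) sub(2) start(2)] by blast
  define t where "t = min t1 t2"
  have t: "0 < t" "t \<le> 1" using 1 2 by (auto simp: t_def)
  have "g1 ` {0..t} \<subseteq> g1 ` {0..t1}" "g2 ` {0..t} \<subseteq> g2 ` {0..t2}" by (auto simp: t_def)
  then have Q: "g1 ` {0..t} \<subseteq> \<phi> ` path_image \<beta>1" "g2 ` {0..t} \<subseteq> \<phi> ` path_image \<beta>2"
    using 1(4) 2(4) by auto
  have "g1 \<noteq> g2"
  proof
    assume eq: "g1 = g2"
    have fg: "free_arc \<Gamma> g1" using star_free[OF S 1(1)] .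
    have ag: "arc g1" using SD(2)[OF 1(1)] .
    \<comment> \<open>The part of the first half sent to the outer piece of the germ. Parameters of
      at least \<open>t/2\<close> keep \<open>C\<close> away from \<open>g0\<close>, the only common
      point of the halves, so \<open>K1\<close> and \<open>K2\<close> are disjoint compact sets with
      a gap \<open>d\<close>.\<close>
    define C where "C = path_image \<beta>1 \<inter> \<phi> -` (g1 ` {t/2..t})"
    have "compact C"
    proof -
      have "closedin (top_of_set (path_image \<beta>1)) (path_image \<beta>1 \<inter> \<phi> -` (g1 ` {t/2..t}))"
        using continuous_on_subset[OF \<phi>cont sub(1)] arc_compact_image[OF ag, of "t/2" t] t
        by (intro continuous_closedin_preimage compact_imp_closed) auto
      then show ?thesis unfolding C_def using closedin_compact compact_arc_image[OF arcs(1)] by blast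
    qed
    have Csub: "C \<subseteq> fib k b" using sub(1) by (auto simp: C_def)
    define K1 where "K1 = (\<lambda>g. k (b, g)) ` C"
    define K2 where "K2 = (\<lambda>g. k (b, g)) ` path_image \<beta>2"
    have "compact K1" unfolding K1_def
      by (rule compact_continuous_image[OF continuous_on_subset[OF kcont Csub] \<open>compact C\<close>])
    have "compact K2" unfolding K2_def
      by (rule compact_continuous_image[OF continuous_on_subset[OF kcont sub(2)] compact_arc_image[OF arcs(2)]])
    have "C \<inter> path_image \<beta>2 = {}"
    proof (rule ccontr)
      assume "C \<inter> path_image \<beta>2 \<noteq> {}"
      then have "g0 \<in> C" using inter by (auto simp: C_def)
      then obtain r where "r \<in> {t/2..t}" "x' = g1 r" by (auto simp: C_def x'_def)
      then show False using SD(3)[OF 1(1)] arc_inj[OF ag, of r 0] t by auto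
    qed
    then have "K1 \<inter> K2 = {}" unfolding K1_def K2_def using kinj Csub sub(2) by blast
    then have "K1 \<subseteq> - K2" by blast
    moreover have "open (- K2)" using compact_imp_closed[OF \<open>compact K2\<close>] by (simp add: open_Compl)
    ultimately obtain d where d: "d > 0" "(\<Union>z\<in>K1. ball z d) \<subseteq> - K2"
      using compact_subset_open_imp_ball_epsilon_subset[OF \<open>compact K1\<close>] by metis
    have \<beta>c: "continuous_on {0..1} \<beta>1" "\<beta>1 ` {0..1} \<subseteq> fib k b"
      using arcs(1) sub(1) by (auto simp: arc_def path_def path_image_def)
    have \<phi>\<beta>: "continuous_on {0..1} (\<lambda>r. \<phi> (\<beta>1 r))" by (rule continuous_on_compose2[OF \<phi>cont \<beta>c])
    \<comment> \<open>Continuity near a preimage of the inner point \<open>g1 (3/4*t)\<close> gives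
      a whole arc \<open>\<gamma>\<close> inside \<open>C\<close>, and with it an open subset of
      \<open>\<Gamma>\<close> to which genericity applies.\<close>
    define P where "P = {0..1} \<inter> (\<lambda>r. \<phi> (\<beta>1 r)) -` (g1 ` {t/2<..<t})"
    have "openin (top_of_set {0..1}) P" unfolding P_def
    proof (rule continuous_openin_preimage[OF \<phi>\<beta>])
      show "(\<lambda>r. \<phi> (\<beta>1 r)) \<in> {0..1} \<rightarrow> \<Gamma>" using \<beta>c(2) F\<phi>(2) by auto
      show "openin (top_of_set \<Gamma>) (g1 ` {t/2<..<t})" using free_subarc_open[OF fg] t by simp
    qed
    moreover obtain r0 where r0: "r0 \<in> P"
    proof -
      have "g1 (3/4*t) \<in> g1 ` {0..t}" using t by auto
      then obtain z where "z \<in> path_image \<beta>1" "g1 (3/4*t) = \<phi> z" using Q(1) by blast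
      then obtain r where "r \<in> {0..1}" "g1 (3/4*t) = \<phi> (\<beta>1 r)" by (auto simp: path_image_def)
      moreover have "g1 (3/4*t) \<in> g1 ` {t/2<..<t}" using t by auto
      ultimately have "r \<in> P" by (simp add: P_def)
      then show thesis by (rule that)
    qed
    ultimately obtain e where e: "e > 0" "ball r0 e \<inter> {0..1} \<subseteq> P"
      unfolding openin_contains_ball by blast
    have "r0 \<in> {0..1}" using r0 by (simp add: P_def)
    then have "max 0 (r0 - e) < min 1 (r0 + e)" using e(1) by auto
    then obtain a where a: "max 0 (r0 - e) < a" "a < min 1 (r0 + e)" using dense by blast
    then obtain a' where a': "a < a'" "a' < min 1 (r0 + e)" using dense by blast
    have "{a..a'} \<subseteq> ball r0 e \<inter> {0..1}" using a a' by (auto simp: dist_real_def)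
    then have aP: "{a..a'} \<subseteq> P" using e(2) by blast
    define \<gamma> where "\<gamma> = segpath \<beta>1 a a'"
    have "arc \<gamma>" unfolding \<gamma>_def using arcs(1) a a' by (intro arc_segpath) auto
    have \<gamma>i: "path_image \<gamma> = \<beta>1 ` {a..a'}" unfolding \<gamma>_def using a'
      by (simp add: path_image_segpath closed_segment_eq_real_ivl)
    have \<gamma>C: "path_image \<gamma> \<subseteq> C"
    proof
      fix z assume "z \<in> path_image \<gamma>"
      then obtain r where r: "r \<in> P" "z = \<beta>1 r" using aP \<gamma>i by blast
      then have "z \<in> path_image \<beta>1" by (auto simp: P_def path_image_def)
      moreover have "\<phi> z \<in> g1 ` {t/2<..<t}" using r by (simp add: P_def)
      moreover have "g1 ` {t/2<..<t} \<subseteq> g1 ` {t/2..t}" by (intro image_mono) auto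
      ultimately show "z \<in> C" unfolding C_def by blast
    qed
    then have "path_image \<gamma> \<subseteq> \<Gamma>" using Csub fib_closed(2)[OF c] by blast
    then obtain W where W: "openin (top_of_set \<Gamma>) W" "W \<noteq> {}" "W \<subseteq> path_image \<gamma>"
      using graph_arc_interior[OF A \<open>arc \<gamma>\<close>] by metis
    then have WC: "W \<subseteq> C" using \<gamma>C by blast
    obtain g where g: "g \<in> W" "k (b, g) \<in> almost_inj_pts M F d"
      using gd[OF d(1) W(1,2)] WC Csub by blast
    have gC: "g \<in> C" using g(1) WC by blast
    have "g1 ` {t/2..t} \<subseteq> g1 ` {0..t}" using t by (intro image_mono) auto
    then have "\<phi> g \<in> \<phi> ` path_image \<beta>2" using gC Q(2) eq unfolding C_def by blast
    \<comment> \<open>\<open>w\<close> lies in the other half and has the same image as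
      \<open>g\<close>, so injectivity up to \<open>d\<close> contradicts the gap.\<close>
    then obtain w where w: "w \<in> path_image \<beta>2" "\<phi> g = \<phi> w" by blast
    have "dist (k (b, g)) (k (b, w)) < d"
    proof (rule almost_inj_ptsD[OF g(2)])
      show "k (b, w) \<in> M" using kM w sub(2) by auto
      show "F (k (b, g)) = F (k (b, w))" using \<phi>eq gC Csub w sub(2) by blast
    qed
    moreover have "k (b, g) \<in> K1" "k (b, w) \<in> K2" using gC w by (auto simp: K1_def K2_def)
    ultimately show False using d(2) by (auto simp: subset_iff)
  qed
  then have "arc_interior_pt (fib k' (f b)) x'"
    by (rule two_germs_arc_interior[OF S 1(1) 2(1) _ t order_trans[OF Q(1) Qf[OF sub(1)]] order_trans[OF Q(2) Qf[OF sub(2)]]])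
  then have "arc_interior_pt (M_fibre (f b)) (k' (f b, x'))" using fib_arc_interior[OF c' x'f] by simp
  then show ?thesis using F\<phi>(1)[OF g0f] g0(2) by (simp add: x'_def)
qed

section \<open>From interior points of \<open>M\<close> to all fibres\<close>

lemma open_set_of_arc_interior_pts:
  assumes V: "openin (top_of_set E) V" "V \<noteq> {}" "V \<subseteq> M"
  obtains W where "openin (top_of_set M) W" "W \<noteq> {}" "\<forall>x\<in>W. arc_interior_pt (M_fibre (p x)) x"
proof -
  obtain A where A: "graph_edges \<Gamma> A" by (rule edges)
  obtain \<J> where \<J>: "\<And>J. J \<in> \<J> \<Longrightarrow> \<exists>q. free_arc \<Gamma> q \<and> J = q ` {0<..<1}"
    "\<And>W. openin (top_of_set \<Gamma>) W \<Longrightarrow> W \<noteq> {} \<Longrightarrow> \<exists>J\<in>\<J>. J \<subseteq> W"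
    using graph_countable_pi_base[OF A] by metis
  obtain V0 where V0: "open V0" "V = E \<inter> V0" using V(1) by (auto simp: openin_open)
  obtain x where x: "x \<in> V" using V(2) by blast
  define b where "b = p x"
  have "b \<in> B" using x V(3) M_onto by (auto simp: b_def)
  then obtain U h k where c: "chart U h k" "b \<in> U" using chart_ex by blast
  have xE: "x \<in> E" "p x \<in> U" using x V0 c(2) by (auto simp: b_def)
  note inv = chart_inverse[OF c(1) xE]
  have "openin (top_of_set (U \<times> \<Gamma>)) ((U \<times> \<Gamma>) \<inter> k -` V0)"
    using continuous_openin_preimage_gen[OF chart_cont(1)[OF c(1)] V0(1)] .
  moreover have "(b, snd (h x)) \<in> (U \<times> \<Gamma>) \<inter> k -` V0" using c(2) inv(1,2) x V0 unfolding b_def by simp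
  ultimately obtain U' V' where UV: "openin (top_of_set U) U'" "b \<in> U'" "openin (top_of_set \<Gamma>) V'" "snd (h x) \<in> V'"
     "U' \<times> V' \<subseteq> (U \<times> \<Gamma>) \<inter> k -` V0"
    using Times_in_interior_subtopology by metis
  have U'B: "openin (top_of_set B) U'" "U' \<subseteq> U"
    using openin_trans[OF UV(1) chartD(1)[OF c(1)]] openin_imp_subset[OF UV(1)] by auto
  obtain q where q: "free_arc \<Gamma> q" "q ` {0<..<1} \<subseteq> V'" using \<J> UV(3,4) by (metis empty_iff)
  have qo: "openin (top_of_set \<Gamma>) (q ` {0<..<1})" "arc q" using q(1) by (auto simp: free_arc_def)
  have inM: "k (b', z) \<in> M" if "b' \<in> U'" "z \<in> q ` {0<..<1}" for b' z
  proof -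
    have "(b', z) \<in> U' \<times> V'" using that q(2) by blast
    then have "(b', z) \<in> U \<times> \<Gamma>" "k (b', z) \<in> V0" using UV(5) by auto
    then show ?thesis using chart_apply(1)[OF c(1)] V0 V(3) by auto
  qed
  have qG: "q ` {0<..<1} \<subseteq> \<Gamma>" using openin_imp_subset[OF qo(1)] .
  show thesis
  proof (rule that[of "k ` (U' \<times> q ` {0<..<1})"]; (intro ballI)?)
    show "openin (top_of_set M) (k ` (U' \<times> q ` {0<..<1}))"
      by (rule openin_E_M[OF chart_open[OF c(1) U'B qo(1)]]) (use inM in auto)
    show "k ` (U' \<times> q ` {0<..<1}) \<noteq> {}" using UV(2) by auto
    show "arc_interior_pt (M_fibre (p y)) y" if y: "y \<in> k ` (U' \<times> q ` {0<..<1})" for y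
    proof -
      obtain b' z where z: "b' \<in> U'" "z \<in> q ` {0<..<1}" "y = k (b', z)" using y by blast
      have b': "b' \<in> U" using z U'B by auto
      have qf: "q ` {0<..<1} \<subseteq> fib k b'" using inM[OF z(1)] qG by (auto simp: fib_def)
      then have "arc_interior_pt (fib k b') z" using arc_interior_pt_arcI[OF qo(2) _ z(2)] by blast
      then have "arc_interior_pt (M_fibre b') y" using fib_arc_interior[OF c(1) b'] qf z by blast
      moreover have "p y = b'" using chart_apply(2)[OF c(1) b'] z qG by auto
      ultimately show ?thesis by simp
    qed
  qed
qed

lemma all_arc_interior_if_interior:
  assumes V: "openin (top_of_set E) V" "V \<noteq> {}" "V \<subseteq> M" and x: "x \<in> M"
  shows "arc_interior_pt (M_fibre (p x)) x"
proof -
  obtain A where A: "graph_edges \<Gamma> A" by (rule edges)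
  obtain B0 where B0: "B0 \<subseteq> B" "\<forall>W. openin (top_of_set B) W \<and> W \<noteq> {} \<longrightarrow> W \<inter> B0 \<noteq> {}"
    "\<forall>b\<in>B. f b \<in> B0 \<longrightarrow> b \<in> B0" "\<forall>b\<in>B0. generic b"
    by (rule generic_base)
  obtain W where W: "openin (top_of_set M) W" "W \<noteq> {}" "\<forall>x\<in>W. arc_interior_pt (M_fibre (p x)) x"
    by (rule open_set_of_arc_interior_pts[OF V])
  \<comment> \<open>Only points over \<open>B0\<close> are collected: preimages of such points again
    lie over \<open>B0\<close>, where \<open>generic_preserves_arc_interior\<close> is
    available.\<close>
  define Z where "Z = {x \<in> M. p x \<in> B0 \<and> \<not> arc_interior_pt (M_fibre (p x)) x}"
  have ZM: "closure Z \<subseteq> M" using compact_imp_closed[OF M_compact] by (intro closure_minimal) (auto simp: Z_def)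
  have "Z \<subseteq> F ` Z"
  proof
    fix z assume z: "z \<in> Z"
    then obtain y where y: "y \<in> M" "z = F y" using minimal_surj[OF F_sys] by (auto simp: Z_def)
    have pz: "p z = f (p y)" using comm_M y by simp
    have "p y \<in> B" using y M_onto by blast
    then have py: "p y \<in> B0" using B0(3) z pz by (simp add: Z_def)
    have "\<not> arc_interior_pt (M_fibre (p y)) y"
      using generic_preserves_arc_interior[OF bspec[OF B0(4) py] y(1) refl] z pz y(2) by (auto simp: Z_def)
    then show "z \<in> F ` Z" using y py by (auto simp: Z_def)
  qed
  have Z0: "Z = {}"
  proof (rule ccontr)
    assume "Z \<noteq> {}"
    have "closedin (top_of_set M) (closure Z)" using ZM by (simp add: closed_subset)
    moreover have "compact (F ` closure Z)"
      using compact_continuous_image[OF continuous_on_subset[OF F_cont_M ZM]] closedin_compact[OF M_compact calculation] by blast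
    \<comment> \<open>\<open>minimal_backward\<close> asks for a closed set; the inclusion passes to
      the closure because the image of the closure is compact.\<close>
    then have "closure Z \<subseteq> F ` closure Z"
      using \<open>Z \<subseteq> F ` Z\<close> closure_subset by (intro closure_minimal compact_imp_closed) blast+
    moreover have "closure Z \<noteq> {}" using \<open>Z \<noteq> {}\<close> by simp
    ultimately have "closure Z = M" by (intro minimal_backward[OF F_sys])
    moreover obtain W0 where W0: "open W0" "W = M \<inter> W0" using W(1) by (auto simp: openin_open)
    ultimately have "W0 \<inter> closure Z \<noteq> {}" using W(2) by blast
    then have "W0 \<inter> Z \<noteq> {}" using open_Int_closure_eq_empty[OF W0(1)] by blast
    then show False using W(3) W0(2) by (auto simp: Z_def)
  qed
  have generic: "arc_interior_pt (M_fibre (p y)) y" if "y \<in> M" "p y \<in> B0" for y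
    using Z0 that by (auto simp: Z_def)
  define b where "b = p x"
  have "b \<in> B" using x M_onto by (auto simp: b_def)
  then obtain U h k where c: "chart U h k" "b \<in> U" using chart_ex by blast
  define \<T> where "\<T> = {T. closed T \<and> T \<subseteq> \<Gamma> \<and> (\<forall>y\<in>T. arc_interior_pt T y)}"
  have fin: "finite \<T>" unfolding \<T>_def by (rule finitely_many_arc_interior_sets[OF A])
  \<comment> \<open>Points of \<open>M\<close> over good base points, sorted by their fibre; by
    \<open>fibT\<close> only finitely many classes occur.\<close>
  define N where "N T = {y \<in> M. p y \<in> U \<inter> B0 \<and> fib k (p y) = T}" for T
  have fibT: "fib k b' \<in> \<T>" if b': "b' \<in> U" "b' \<in> B0" for b'
  proof -
    have "arc_interior_pt (fib k b') g" if g: "g \<in> fib k b'" for g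
    proof -
      have "k (b', g) \<in> M" "p (k (b', g)) = b'" using g chart_apply[OF c(1) b'(1)] by (auto simp: fib_def)
      then have "arc_interior_pt (M_fibre b') (k (b', g))" using generic[of "k (b', g)"] b'(2) by simp
      then show ?thesis using fib_arc_interior[OF c(1) b'(1) g] by simp
    qed
    then show ?thesis unfolding \<T>_def using fib_closed[OF c(1) b'(1)] by simp
  qed
  \<comment> \<open>Points over \<open>B0\<close> are dense in \<open>M\<close>, since
    \<open>p\<close> is semi-open on \<open>M\<close> and \<open>B0\<close> meets every nonempty
    open set.\<close>
  have "x \<in> closure (\<Union>T\<in>\<T>. N T)"
    unfolding closure_iff_nhds_not_empty
  proof (intro allI impI)
    fix O1 O2 assume O: "O2 \<subseteq> O1" "open O2" "x \<in> O2"
    define W1 where "W1 = (M \<inter> p -` U) \<inter> O2"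
    have "openin (top_of_set M) (M \<inter> p -` U)"
      by (rule continuous_openin_preimage[OF p_cont_M _ chartD(1)[OF c(1)]]) (use M_onto in auto)
    then have "openin (top_of_set M) W1" unfolding W1_def using O(2) by (rule openin_Int_open)
    moreover have "x \<in> W1" using x c(2) O(3) by (simp add: W1_def b_def)
    ultimately obtain V1 where V1: "openin (top_of_set B) V1" "V1 \<noteq> {}" "V1 \<subseteq> p ` W1" using p_semiopen by blast
    then obtain b' where "b' \<in> V1" "b' \<in> B0" using B0(2) by blast
    then obtain y where y: "y \<in> W1" "p y \<in> B0" using V1(3) by blast
    then have "y \<in> N (fib k (p y))" "fib k (p y) \<in> \<T>" using fibT by (auto simp: N_def W1_def)
    then show "(\<Union>T\<in>\<T>. N T) \<inter> O1 \<noteq> {}" using y O(1) unfolding W1_def by blast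
  qed
  \<comment> \<open>A finite union lets the closure be taken class by class, so \<open>x\<close> is
    a limit of points over which the fibre is one fixed set \<open>T\<close>.\<close>
  moreover have "closure (\<Union>T\<in>\<T>. N T) \<subseteq> (\<Union>T\<in>\<T>. closure (N T))"
    using fin closure_subset by (intro closure_minimal UN_mono closed_UN) auto
  ultimately obtain T where T: "T \<in> \<T>" "x \<in> closure (N T)" by blast
  then obtain xs where xs: "\<And>n. xs n \<in> N T" "xs \<longlonglongrightarrow> x" unfolding closure_sequential by blast
  have xsM: "xs n \<in> M" "p (xs n) \<in> U" "fib k (p (xs n)) = T" "xs n \<in> E" for n
    using xs(1)[of n] M_sub by (auto simp: N_def)
  have xE: "x \<in> E" "p x \<in> U" using x M_sub c(2) by (auto simp: b_def)
  have Tc: "closed T" "T \<subseteq> \<Gamma>" "\<And>y. y \<in> T \<Longrightarrow> arc_interior_pt T y" using T(1) by (auto simp: \<T>_def)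
  have "(\<lambda>n. h (xs n)) \<longlonglongrightarrow> h x"
    by (rule continuous_on_tendsto_compose[OF chart_cont(2)[OF c(1)] xs(2)]) (use xE xsM in auto)
  then have "(\<lambda>n. snd (h (xs n))) \<longlonglongrightarrow> snd (h x)" by (rule tendsto_snd)
  moreover have "snd (h (xs n)) \<in> T" for n
    using chart_inverse[OF c(1) xsM(4) xsM(2), of n] xsM(1,3)[of n] by (auto simp: fib_def)
  ultimately have xT: "snd (h x) \<in> T" using closed_sequentially[OF Tc(1), of "\<lambda>n. snd (h (xs n))" "snd (h x)"] by simp
  have px: "(\<lambda>n. p (xs n)) \<longlonglongrightarrow> b" unfolding b_def
    by (rule continuous_on_tendsto_compose[OF p_cont xs(2)]) (use xE xsM in auto)
  \<comment> \<open>The limit fibre may be larger than \<open>T\<close>. Inclusion suffices, as an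
    arc in \<open>T\<close> is also an arc in the larger set.\<close>
  have "T \<subseteq> fib k b"
  proof
    fix t assume t: "t \<in> T"
    have "(\<lambda>n. k (p (xs n), t)) \<longlonglongrightarrow> k (b, t)"
      by (rule continuous_on_tendsto_compose[OF chart_cont(1)[OF c(1)] tendsto_Pair[OF px tendsto_const]])
         (use c(2) xsM(2) t Tc(2) in auto)
    moreover have "k (p (xs n), t) \<in> M" for n using t xsM(3)[of n] by (auto simp: fib_def)
    ultimately have "k (b, t) \<in> M" using closed_sequentially[OF compact_imp_closed[OF M_compact], of "\<lambda>n. k (p (xs n), t)" "k (b, t)"] by simp
    then show "t \<in> fib k b" using t Tc(2) by (auto simp: fib_def)
  qed
  then have "arc_interior_pt (fib k b) (snd (h x))" "snd (h x) \<in> fib k b"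
    using arc_interior_pt_mono[OF Tc(3)[OF xT]] xT by auto
  then have "arc_interior_pt (M_fibre b) (k (b, snd (h x)))" using fib_arc_interior[OF c] by blast
  then show ?thesis using chart_inverse(2)[OF c(1) xE] by (simp add: b_def)
qed

lemma fib_all_arc_interior:
  assumes V: "openin (top_of_set E) V" "V \<noteq> {}" "V \<subseteq> M" and c: "chart U h k" "b \<in> U" and g: "g \<in> fib k b"
  shows "arc_interior_pt (fib k b) g"
proof -
  have "k (b, g) \<in> M" "p (k (b, g)) = b" using g chart_apply[OF c] by (auto simp: fib_def)
  then have "arc_interior_pt (M_fibre b) (k (b, g))" using all_arc_interior_if_interior[OF V] by metis
  then show ?thesis using fib_arc_interior[OF c g] by simp
qed

lemma End_empty_if_interior:
  assumes V: "openin (top_of_set E) V" "V \<noteq> {}" "V \<subseteq> M"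
  shows "End_of E B p M = {}"
proof -
  obtain A where A: "graph_edges \<Gamma> A" by (rule edges)
  have "star_like_interior_pt (M_fibre (p x)) x" if x: "x \<in> M" for x
  proof -
    have "p x \<in> B" using x M_onto by blast
    then obtain U h k where c: "chart U h k" "p x \<in> U" using chart_ex by blast
    have xb: "x \<in> M_fibre (p x)" using x M_sub by (auto simp: M_fibre_def)
    define g where "g = snd (h x)"
    have gf: "g \<in> fib k (p x)" using chart_inverse[OF c(1) _ c(2)] x M_sub by (auto simp: g_def fib_def)
    then have "g \<in> \<Gamma>" by (simp add: fib_def)
    then obtain S where S: "star_at \<Gamma> g S" by (rule graph_star[OF A])
    have "star_like_interior_pt (fib k (p x)) g"
      by (rule star_like_if_arc_interior[OF S fib_closed[OF c] fib_all_arc_interior[OF V c] gf])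
    then show ?thesis using star_like_homeomorphism[OF fib_homeomorphism[OF c] xb] by (simp add: g_def)
  qed
  then show ?thesis unfolding End_of_eq by blast
qed

text \<open>With interior points every fibre would be a nonempty closed set of arc-interior points
  in \<open>\<Gamma>\<close> and would contain a circle.\<close>

lemma no_interior_if_tree:
  assumes V: "openin (top_of_set E) V" "V \<subseteq> M" and tree: "is_tree \<Gamma>"
  shows "V = {}"
proof (rule ccontr)
  assume ne: "V \<noteq> {}"
  obtain A where A: "graph_edges \<Gamma> A" by (rule edges)
  obtain x where x: "x \<in> M" using M_ne by blast
  then have "p x \<in> B" using M_onto by blast
  then obtain U h k where c: "chart U h k" "p x \<in> U" using chart_ex by blast
  have "snd (h x) \<in> fib k (p x)" using chart_inverse[OF c(1) _ c(2)] x M_sub by (auto simp: fib_def)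
  then have "fib k (p x) \<noteq> {}" by blast
  then obtain C where "C \<subseteq> fib k (p x)" "is_circle C"
    using arc_interior_set_contains_circle[OF A fib_closed[OF c] _ fib_all_arc_interior[OF V(1) ne V(2) c]] by blast
  then show False using tree fib_closed(2)[OF c] unfolding is_tree_def by blast
qed

section \<open>The dichotomy\<close>

lemma End_dense_if_no_interior:
  assumes "\<And>V. openin (top_of_set E) V \<Longrightarrow> V \<subseteq> M \<Longrightarrow> V = {}"
  shows "closure (End_of E B p M) = M"
proof
  have clM: "closed M" using compact_imp_closed[OF M_compact] .
  show "closure (End_of E B p M) \<subseteq> M" using clM by (intro closure_minimal) (auto simp: End_of_eq)
  show "M \<subseteq> closure (End_of E B p M)"
  proof (rule ccontr)
    assume "\<not> M \<subseteq> closure (End_of E B p M)"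
    then have "M \<inter> - closure (End_of E B p M) \<noteq> {}" by blast
    moreover have "openin (top_of_set M) (M \<inter> - closure (End_of E B p M))" by (simp add: openin_open_Int open_Compl)
    moreover have "(M \<inter> - closure (End_of E B p M)) \<inter> End_of E B p M = {}" using closure_subset by auto
    ultimately show False using interior_if_misses_End assms by blast
  qed
qed

end

theorem theoremA:
  fixes E :: "'e::metric_space set" and B :: "'b::metric_space set"
    and \<Gamma> :: "'g::metric_space set"
    and p :: "'e \<Rightarrow> 'b" and F :: "'e \<Rightarrow> 'e" and f :: "'b \<Rightarrow> 'b" and M :: "'e set"
  assumes cgb: "compact_graph_bndl E B p \<Gamma>"
    and F_cont: "continuous_on E F" and F_maps: "F ` E \<subseteq> E"
    and f_cont: "continuous_on B f" and f_maps: "f ` B \<subseteq> B"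
    and comm: "\<forall>x\<in>E. p (F x) = f (p x)"
    and f_min: "minimal_on B f"
    and M_min: "minimal_set E F M"
    and M_onto: "p ` M = B"
  shows "((closure (End_of E B p M) = M) \<noteq> (End_of E B p M = {}))
    \<and> (closure (End_of E B p M) = M \<longleftrightarrow>
         (top_of_set E) interior_of ((top_of_set E) closure_of M) = {})
    \<and> (End_of E B p M = {} \<longleftrightarrow> (top_of_set E) interior_of M \<noteq> {})
    \<and> (is_tree \<Gamma> \<longrightarrow> (top_of_set E) interior_of ((top_of_set E) closure_of M) = {})"
proof -
  interpret bundle_system E B p \<Gamma> F f M by unfold_locales (fact assms)+
  let ?I = "(top_of_set E) interior_of M"
  \<comment> \<open>As \<open>M\<close> is closed in \<open>E\<close>, being nowhere dense means
    having empty interior.\<close>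
  have cl: "(top_of_set E) closure_of M = M" using M_closedin by (simp add: closure_of_closedin)
  have I: "openin (top_of_set E) ?I" "?I \<subseteq> M" by (simp_all add: interior_of_subset)
  have "End_of E B p M = {}" if "?I \<noteq> {}" by (rule End_empty_if_interior[OF I(1) that I(2)])
  moreover have "closure (End_of E B p M) = M" if "?I = {}"
    by (rule End_dense_if_no_interior) (use that interior_of_maximal in blast)
  \<comment> \<open>With this exclusion, the two implications on \<open>?I\<close> become
    equivalences by propositional reasoning.\<close>
  moreover have "End_of E B p M = {} \<Longrightarrow> closure (End_of E B p M) \<noteq> M" using M_ne by auto
  moreover have "is_tree \<Gamma> \<Longrightarrow> ?I = {}" by (rule no_interior_if_tree[OF I])
  ultimately show ?thesis unfolding cl by blast
qed

end
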